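(* For any positive integer $N$ and any partition $\lambda$ with $|\lambda|<N$, $$\int_{U(N)}P_\lambda(U)\,\overline{w_O(U)}\,dU=\int_{O(N)}P_\lambda(U)\,dU,$$ where $w_O(U)=\prod_{1\le i\le j\le N}\frac{1}{1-x_ix_j}$ with $x_1,\dots,x_N$ the eigenvalues of $U$, and both integrals are against Haar probability measures.
   Context: For a partition $\lambda=1^{\lambda_1}2^{\lambda_2}\cdots k^{\lambda_k}$ ($\lambda_j$ parts equal to $j$), $|\lambda|=\sum_j j\lambda_j$ and $P_\lambda(U)=\prod_j\mathrm{Tr}(U^j)^{\lambda_j}$. $U(N)$ is the unitary group and $O(N)$ the orthogonal group of $N\times N$ matrices.
   Formalization: Since w_O is not integrable on U(N) (e.g. N=1: 1/(1-x^2) on the unit circle), the left-hand integral is read as the limit, as r tends to 1 from below, of the integral of P_λ(U) times the conjugate of w_O(rU), i.e. w_O at the eigenvalues r x_i. *)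

theory Defs
  imports
    "HOL-Analysis.Analysis"
    "HOL-Probability.Probability_Measure"
    "HOL-Computational_Algebra.Computational_Algebra"
begin

definition unitary_group :: "(complex ^ 'n ^ 'n) set" where
  "unitary_group =
    {U. map_matrix cnj (transpose U) ** U = mat 1 \<and> U ** map_matrix cnj (transpose U) = mat 1}"

definition orthogonal_group :: "(real ^ 'n ^ 'n) set" where
  "orthogonal_group = {Q. orthogonal_matrix Q}"

text \<open>
  The group \<^term>\<open>G\<close> carries the subspace topology of the space of matrices. The groups of interest
  are compact, so left invariance together with total mass one determines \<^term>\<open>M\<close> uniquely.
\<close>

definition haar_prob_measure ::
    "('a::{semiring_1, topological_space} ^ 'n ^ 'n) set \<Rightarrow> ('a ^ 'n ^ 'n) measure \<Rightarrow> bool" where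
  "haar_prob_measure G M \<longleftrightarrow>
    prob_space M \<and> sets M = sets (restrict_space borel G) \<and>
    (\<forall>g\<in>G. distr M M (\<lambda>h. g ** h) = M)"

text \<open>The operation \<open>^\<close> is not available here: multiplication on type \<open>vec\<close> is componentwise.\<close>

definition matrix_power :: "'a::semiring_1 ^ 'n ^ 'n \<Rightarrow> nat \<Rightarrow> 'a ^ 'n ^ 'n" where
  "matrix_power A k = (((**) A) ^^ k) (mat 1)"

text \<open>
  A partition is the multiset of its (positive) parts: the number of parts equal to \<open>j\<close>
  is \<^term>\<open>count l j\<close>.
\<close>

definition is_partition :: "nat multiset \<Rightarrow> bool" where
  "is_partition l \<longleftrightarrow> 0 \<notin># l"

definition partition_size :: "nat multiset \<Rightarrow> nat" where
  "partition_size l = (\<Sum>j\<in>set_mset l. j * count l j)"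

definition power_sum_trace :: "nat multiset \<Rightarrow> 'a::comm_semiring_1 ^ 'n ^ 'n \<Rightarrow> 'a" where
  "power_sum_trace l U = (\<Prod>j\<in>set_mset l. trace (matrix_power U j) ^ count l j)"

definition characteristic_poly :: "complex ^ 'n ^ 'n \<Rightarrow> complex poly" where
  "characteristic_poly A = det (\<chi> i j. (if i = j then [:0, 1:] else 0) - [:A $ i $ j:])"

text \<open>
  The eigenvalues, listed with algebraic multiplicity; the list has length \<open>CARD('n)\<close>. The
  order is arbitrary, which is harmless since only symmetric functions of the list are used.
\<close>

definition eigenvalue_list :: "complex ^ 'n ^ 'n \<Rightarrow> complex list" where
  "eigenvalue_list A = (SOME xs. mset xs = proots (characteristic_poly A))"

text \<open>
  On the unitary group \<open>weight_O\<close> has non-integrable poles (already \<open>1 / (1 - x^2)\<close> on the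
  unit circle). Integrals against it are therefore taken as radial boundary values: it is evaluated
  at \<open>r *\<^sub>R U\<close> with \<open>0 < r < 1\<close>, where the eigenvalues are \<open>r * x i\<close>, and \<open>r\<close> tends to \<open>1\<close> from below.
\<close>

definition weight_O :: "complex ^ 'n ^ 'n \<Rightarrow> complex" where
  "weight_O A = (let x = (\<lambda>i. eigenvalue_list A ! i) in
    \<Prod>(i, j)\<in>{(i, j). i \<le> j \<and> j < CARD('n)}. 1 / (1 - x i * x j))"

end

theory Submission
  imports Defs
begin

text \<open>
  Both sides equal the same moment of independent real Gaussian variables \<open>X\<^sub>j\<close> (\<open>j \<ge> 1\<close>) with
  mean \<open>1\<close> for even and \<open>0\<close> for odd \<open>j\<close> and with variance \<open>j\<close>, where \<open>X\<^sub>j\<close> replaces \<open>Tr (U\<^sup>j)\<close>.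

  Invariance of the measure under one-parameter subgroups gives Schwinger--Dyson (loop) equations for
  the expectations of products of traces. Among partitions of \<open>n\<close> their top-degree part is \<open>c\<close> times the
  identity plus \<open>n - 1\<close> unit weights, with \<open>c = N\<close> for \<open>U(N)\<close> and \<open>c = N - 1\<close> for \<open>O(N)\<close>. It is
  therefore diagonally dominant when \<open>n \<le> N\<close>, respectively \<open>n < N\<close>, and the equations determine the
  expectations by induction on \<open>n\<close>. On \<open>O(N)\<close> the Gaussian moments solve them. On \<open>U(N)\<close> the solution is
  the orthogonality relation of Diaconis and Shahshahani: multiplication by \<open>p\<^sub>k\<close> is adjoint to
  \<open>k \<partial>/\<partial>p\<^sub>k\<close>. Finally \<open>w\<^sub>O = exp (\<Sum>\<^sub>k (p\<^sub>k\<^sup>2 + p\<^sub>2\<^sub>k) / (2 k))\<close>, so that pairing with \<open>w\<^sub>O\<close> is a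
  Gaussian expectation; at radius \<open>r\<close> only its homogeneous part of degree \<open>n\<close> contributes, with a
  factor \<open>r\<^sup>n\<close>.
\<close>

section \<open>Cut-and-join equations on partitions\<close>

no_notation fps_nth (infixl "$" 75)

lemma sum_mset_remove1_eq:
  fixes H :: "'a::comm_monoid_add multiset"
  assumes "m \<in># H"
  shows "m + \<Sum>\<^sub># (H - {#m#}) = \<Sum>\<^sub># H"
  using arg_cong[OF insert_DiffM[OF assms], of sum_mset] by simp

lemma sum_mset_conv_sum:
  fixes f :: "'a \<Rightarrow> 'b::comm_semiring_1"
  assumes "finite S" "set_mset F \<subseteq> S"
  shows "(\<Sum>m\<in>#F. f m) = (\<Sum>m\<in>S. of_nat (count F m) * f m)"
  using assms(2)
proof (induction F)
  case (add x F)
  have "(\<Sum>m\<in>S. of_nat (count (add_mset x F) m) * f m) = (\<Sum>m\<in>S. of_nat (count F m) * f m + (if m = x then f x else 0))"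
    by (intro sum.cong) (auto simp: algebra_simps)
  with add assms(1) show ?case by (simp add: sum.distrib add.commute)
qed simp

lemma set_mset_partition_subset:
  assumes "is_partition F"
  shows "set_mset F \<subseteq> {1..\<Sum>\<^sub># F}"
  using assms by (induction F) (fastforce simp: is_partition_def)+

lemma finite_partitions: "finite {F. is_partition F \<and> \<Sum>\<^sub># F = n}"
proof (rule finite_subset)
  have "size F \<le> \<Sum>\<^sub># F \<and> set_mset F \<subseteq> {..\<Sum>\<^sub># F}" if "is_partition F" for F
    using that by (induction F) (fastforce simp: is_partition_def)+
  thus "{F. is_partition F \<and> \<Sum>\<^sub># F = n} \<subseteq> (\<Union>k\<in>{..n}. multisets_of_size {..n} k)"
    by (auto simp: multisets_of_size_def)
qed auto

lemma partition_size_conv_sum_mset: "partition_size l = \<Sum>\<^sub># l"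
  using sum_mset_conv_sum[of "set_mset l" l "\<lambda>j. j"]
  by (simp add: partition_size_def mult.commute)

text \<open>
  The left-hand side is the Jucys--Murphy action. It has \<open>n - 1\<close> unit off-diagonal
  weights, so for \<open>c > n - 1\<close> it is diagonally dominant and hence injective.
\<close>

lemma cut_join_injective:
  fixes v :: "nat multiset \<Rightarrow> complex" and c :: real
  assumes eq: "\<And>k F. 0 < k \<Longrightarrow> is_partition F \<Longrightarrow> k + \<Sum>\<^sub># F = n \<Longrightarrow>
      of_real c * v (add_mset k F) + (\<Sum>a\<in>{1..<k}. v (add_mset a (add_mset (k - a) F)))
        + (\<Sum>m\<in>#F. of_nat m * v (add_mset (k + m) (F - {#m#}))) = 0"
    and "0 < n" "n < c + 1" and "is_partition F" "\<Sum>\<^sub># F = n"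
  shows "v F = 0"
proof -
  let ?P = "{F. is_partition F \<and> \<Sum>\<^sub># F = n}"
  define B where "B = Max ((\<lambda>F. norm (v F)) ` ?P)"
  have fin: "finite ((\<lambda>F. norm (v F)) ` ?P)"
    using finite_partitions by blast
  have le: "norm (v G) \<le> B" if "is_partition G" "\<Sum>\<^sub># G = n" for G
    unfolding B_def by (rule Max_ge[OF fin]) (use that in auto)
  have "B \<in> (\<lambda>F. norm (v F)) ` ?P"
    unfolding B_def by (rule Max_in[OF fin]) (use assms(4,5) in auto)
  then obtain G where G: "is_partition G" "\<Sum>\<^sub># G = n" "norm (v G) = B"
    by auto
  obtain k H where kH: "G = add_mset k H"
    using G(2) \<open>0 < n\<close> by (cases G) auto
  have k: "0 < k" and H: "is_partition H" "k + \<Sum>\<^sub># H = n"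
    using G kH by (auto simp: is_partition_def intro: Nat.gr0I)
  have B0: "0 \<le> B" using G(3) norm_ge_zero by metis
  have c: "0 \<le> c" using assms(2,3) by linarith
  have 1: "norm (\<Sum>a\<in>{1..<k}. v (add_mset a (add_mset (k - a) H))) \<le> (k - 1) * B"
  proof -
    have "norm (\<Sum>a\<in>{1..<k}. v (add_mset a (add_mset (k - a) H))) \<le> (\<Sum>a\<in>{1..<k}. B)"
      by (intro sum_norm_le le) (use H in \<open>auto simp: is_partition_def\<close>)
    thus ?thesis by simp
  qed
  have 2: "norm (\<Sum>m\<in>#H. of_nat m * v (add_mset (k + m) (H - {#m#}))) \<le> (\<Sum>\<^sub># H) * B"
  proof -
    have "norm (\<Sum>m\<in>#H. of_nat m * v (add_mset (k + m) (H - {#m#})))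
      = norm (\<Sum>m\<in>set_mset H. of_nat (count H m) * (of_nat m * v (add_mset (k + m) (H - {#m#}))))"
      by (subst sum_mset_conv_sum[of "set_mset H"]) auto
    also have "\<dots> \<le> (\<Sum>m\<in>set_mset H. real (count H m) * (real m * B))"
    proof (intro sum_norm_le)
      fix m assume m: "m \<in># H"
      have "norm (v (add_mset (k + m) (H - {#m#}))) \<le> B"
      proof (rule le)
        show "is_partition (add_mset (k + m) (H - {#m#}))"
          using H k by (auto simp: is_partition_def dest: in_diffD)
        have "\<Sum>\<^sub># H = m + \<Sum>\<^sub># (H - {#m#})"
          using sum_mset_remove1_eq[OF m] by simp
        thus "\<Sum>\<^sub># (add_mset (k + m) (H - {#m#})) = n"
          using H by simp
      qed
      thus "norm (of_nat (count H m) * (of_nat m * v (add_mset (k + m) (H - {#m#})))) \<le> real (count H m) * (real m * B)"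
        by (simp add: norm_mult mult_left_mono)
    qed
    also have "\<dots> = (\<Sum>\<^sub># H) * B"
      using sum_mset_conv_sum[of "set_mset H" H "\<lambda>j. j"]
      by (simp add: sum_distrib_right mult.assoc)
    finally show ?thesis .
  qed
  have "c * B = norm (of_real c * v G)"
    using c G by (simp add: norm_mult)
  also have "of_real c * v G = - ((\<Sum>a\<in>{1..<k}. v (add_mset a (add_mset (k - a) H)))
        + (\<Sum>m\<in>#H. of_nat m * v (add_mset (k + m) (H - {#m#}))))"
    using eq[OF k H] unfolding kH by (intro iffD2[OF eq_neg_iff_add_eq_0]) (simp only: add.assoc)
  also have "norm \<dots> \<le> (k - 1) * B + (\<Sum>\<^sub># H) * B"
    unfolding norm_minus_cancel by (intro norm_triangle_le add_mono 1 2)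
  also have "\<dots> = (real n - 1) * B"
    using H k by (simp flip: H(2) add: algebra_simps of_nat_diff)
  finally have "(c - (real n - 1)) * B \<le> 0"
    by (simp add: algebra_simps)
  with \<open>n < c + 1\<close> have "B \<le> 0"
    by (simp add: mult_le_0_iff)
  thus ?thesis using le[OF assms(4,5)] norm_ge_zero[of "v F"] by (simp only: norm_le_zero_iff[symmetric])
qed

section \<open>Gaussian moments\<close>

definition nat_dist :: "nat \<Rightarrow> nat \<Rightarrow> nat" where
  "nat_dist a b = (a - b) + (b - a)"

lemma count_add_mset_diff:
  fixes M :: "'a multiset \<Rightarrow> 'b::comm_semiring_1"
  shows "of_nat (count (add_mset b F) a) * M (add_mset b F - {#a#}) =
    of_nat (count F a) * M (add_mset b (F - {#a#})) + (if a = b then M F else 0)"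
proof (cases "a \<in># F")
  case True
  thus ?thesis by (auto simp: algebra_simps)
next
  case False
  thus ?thesis by (auto simp: not_in_iff)
qed

text \<open>
  The variable with index \<open>0\<close> is the constant \<open>N\<close>, matching \<open>Tr (U\<^sup>0) = N\<close>. The recursion in
  \<open>gauss_moment1\<close> is Gaussian integration by parts.
\<close>

definition gauss_mean :: "nat \<Rightarrow> nat \<Rightarrow> complex" where
  "gauss_mean N j = (if j = 0 then of_nat N else of_bool (even j))"

fun gauss_moment1 :: "nat \<Rightarrow> nat \<Rightarrow> nat \<Rightarrow> complex" where
  "gauss_moment1 N j 0 = 1"
| "gauss_moment1 N j (Suc 0) = gauss_mean N j"
| "gauss_moment1 N j (Suc (Suc l)) =
    gauss_mean N j * gauss_moment1 N j (Suc l) + of_nat (j * Suc l) * gauss_moment1 N j l"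

definition gauss_moment :: "nat \<Rightarrow> nat multiset \<Rightarrow> complex" where
  "gauss_moment N F = (\<Prod>j\<in>set_mset F. gauss_moment1 N j (count F j))"

lemma gauss_moment_superset:
  assumes "finite S" "set_mset F \<subseteq> S"
  shows "gauss_moment N F = (\<Prod>j\<in>S. gauss_moment1 N j (count F j))"
  unfolding gauss_moment_def
  by (rule prod.mono_neutral_left) (use assms in \<open>auto simp: not_in_iff\<close>)

lemma gauss_moment_empty [simp]: "gauss_moment N {#} = 1"
  by (simp add: gauss_moment_def)

lemma gauss_moment_add_mset:
  "gauss_moment N (add_mset k F) =
    gauss_mean N k * gauss_moment N F + of_nat k * of_nat (count F k) * gauss_moment N (F - {#k#})"
proof -
  let ?S = "insert k (set_mset F)" and ?R = "set_mset F - {k}"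
  let ?r = "\<Prod>j\<in>?R. gauss_moment1 N j (count F j)"
  have S: "(\<Prod>j\<in>?S. f j) = f k * (\<Prod>j\<in>?R. f j)" for f :: "nat \<Rightarrow> complex"
    by (subst prod.insert_remove) auto
  have 1: "gauss_moment N (add_mset k F) = gauss_moment1 N k (Suc (count F k)) * ?r"
    unfolding gauss_moment_superset[of ?S "add_mset k F", simplified] S
    by simp
  have 2: "gauss_moment N F = gauss_moment1 N k (count F k) * ?r"
    by (subst gauss_moment_superset[of ?S]) (auto simp: S)
  have 3: "gauss_moment N (F - {#k#}) = gauss_moment1 N k (count F k - 1) * ?r"
    by (subst gauss_moment_superset[of ?S]) (auto simp: S dest: in_diffD)
  show ?thesis
    unfolding 1 2 3 by (cases "count F k") (auto simp: algebra_simps)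
qed

lemma sum_nat_dist_eq:
  fixes f :: "nat \<Rightarrow> 'a::comm_semiring_1"
  assumes "f 0 = 0"
  shows "(\<Sum>a\<in>{1..<k}. f (nat_dist a (k - a))) = 2 * (\<Sum>m\<in>{1..<k}. of_bool (even (k + m)) * f m)"
proof -
  let ?E = "{m\<in>{1..<k}. even (k + m)}"
  have "(\<Sum>a\<in>{1..<k}. f (nat_dist a (k - a))) =
      (\<Sum>a\<in>{a\<in>{1..<k}. 2 * a < k} \<union> {a\<in>{1..<k}. k < 2 * a}. f (nat_dist a (k - a)))"
    by (rule sum.mono_neutral_right) (auto simp: nat_dist_def assms, metis assms diff_self_eq_0 linorder_neqE_nat mult_2)
  also have "\<dots> = (\<Sum>a\<in>{a\<in>{1..<k}. 2 * a < k}. f (nat_dist a (k - a))) + (\<Sum>a\<in>{a\<in>{1..<k}. k < 2 * a}. f (nat_dist a (k - a)))"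
    by (rule sum.union_disjoint) auto
  also have "(\<Sum>a\<in>{a\<in>{1..<k}. 2 * a < k}. f (nat_dist a (k - a))) = (\<Sum>m\<in>?E. f m)"
    by (rule sum.reindex_bij_witness[of _ "\<lambda>m. (k - m) div 2" "\<lambda>a. k - 2 * a"])
       (auto simp: nat_dist_def elim!: evenE intro!: arg_cong[of _ _ f], presburger+)
  also have "(\<Sum>a\<in>{a\<in>{1..<k}. k < 2 * a}. f (nat_dist a (k - a))) = (\<Sum>m\<in>?E. f m)"
    by (rule sum.reindex_bij_witness[of _ "\<lambda>m. (k + m) div 2" "\<lambda>a. 2 * a - k"])
       (simp_all add: nat_dist_def, (presburger | (rule arg_cong[of _ _ f], presburger))+)
  also have "(\<Sum>m\<in>?E. f m) = (\<Sum>m\<in>{1..<k}. of_bool (even (k + m)) * f m)"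
    unfolding sum.inter_filter[OF finite_atLeastLessThan] by (intro sum.cong) auto
  finally show ?thesis by (simp add: mult_2)
qed

lemma sum_even_even:
  "(\<Sum>a\<in>{1..<2 * Suc q}. of_bool (even a)) = (of_nat q :: 'a::comm_semiring_1)"
proof (induction q)
  case 0
  have "{1..<2 * Suc 0} = {1}" by auto
  thus ?case by simp
qed (simp add: sum.atLeastLessThan_Suc add.commute)


lemma sum_mset_partition:
  fixes f :: "nat \<Rightarrow> complex"
  assumes "is_partition F" "\<Sum>\<^sub># F \<le> L"
  shows "(\<Sum>m\<in>#F. of_nat m * f m) = (\<Sum>m\<in>{1..L}. of_nat m * of_nat (count F m) * f m)"
  using set_mset_partition_subset[OF assms(1)] assms(2)
  by (subst sum_mset_conv_sum[of "{1..L}"]) (auto intro!: sum.cong simp: algebra_simps)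

lemma sum_split_at:
  fixes f :: "nat \<Rightarrow> complex"
  assumes "0 < k"
  shows "(\<Sum>m\<in>{1..k + L}. f m) = (\<Sum>m\<in>{1..<k}. f m) + f k + (\<Sum>j\<in>{1..L}. f (k + j))"
proof -
  have "{1..k + L} = {1..<k} \<union> ({k} \<union> {k + 1..k + L})" using assms by auto
  hence "(\<Sum>m\<in>{1..k + L}. f m) = (\<Sum>m\<in>{1..<k}. f m) + (f k + (\<Sum>m\<in>{k + 1..k + L}. f m))"
    by (simp only:) (subst sum.union_disjoint; auto)+
  also have "(\<Sum>m\<in>{k + 1..k + L}. f m) = (\<Sum>j\<in>{1..L}. f (k + j))"
    by (rule sum.reindex_bij_witness[of _ "\<lambda>j. k + j" "\<lambda>m. m - k"]) auto
  finally show ?thesis by (simp add: add.assoc)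
qed

lemma gauss_mean_convolution:
  assumes "0 < k"
  shows "(of_nat N - 1) * gauss_mean N k + (\<Sum>a\<in>{1..<k}. gauss_mean N a * gauss_mean N (k - a))
      + (\<Sum>a\<in>{1..<k}. if a = k - a then of_nat a else 0)
    = (\<Sum>a\<in>{1..<k}. gauss_mean N (nat_dist a (k - a)))"
proof (cases "even k")
  case True
  then obtain q where q: "k = 2 * Suc q"
    using assms by (metis evenE mult_0_right nat_neq_iff not0_implies_Suc)
  have 1: "(\<Sum>a\<in>{1..<k}. gauss_mean N a * gauss_mean N (k - a)) = of_nat q"
    unfolding sum_even_even[of q, symmetric] q
    by (intro sum.cong) (auto simp: gauss_mean_def)
  have "(\<Sum>a\<in>{1..<k}. if a = k - a then of_nat a else 0) = (\<Sum>a\<in>{1..<k}. if a = Suc q then complex_of_nat a else 0)"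
    by (intro sum.cong) (auto simp: q)
  hence 2: "(\<Sum>a\<in>{1..<k}. if a = k - a then of_nat a else 0) = complex_of_nat (Suc q)"
    by (simp add: q)
  have "(\<Sum>a\<in>{1..<k}. gauss_mean N (nat_dist a (k - a))) = (\<Sum>a\<in>{1..<k}. 1 + (if a = Suc q then of_nat N - 1 else 0))"
    by (intro sum.cong) (auto simp: q gauss_mean_def nat_dist_def)
  hence 3: "(\<Sum>a\<in>{1..<k}. gauss_mean N (nat_dist a (k - a))) = complex_of_nat (k - 1) + (of_nat N - 1)"
    by (simp add: q sum.distrib)
  show ?thesis unfolding 1 2 3 by (simp add: q gauss_mean_def)
next
  case False
  have "gauss_mean N a * gauss_mean N (k - a) = 0" "a \<noteq> k - a" "gauss_mean N (nat_dist a (k - a)) = 0"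
    if "a \<in> {1..<k}" for a
  proof -
    show "a \<noteq> k - a" using that False by presburger
    thus "gauss_mean N a * gauss_mean N (k - a) = 0" "gauss_mean N (nat_dist a (k - a)) = 0"
      using that False by (auto simp: gauss_mean_def nat_dist_def)
  qed
  thus ?thesis using False assms by (simp add: gauss_mean_def)
qed

lemma gauss_moment_loop_equation:
  assumes "0 < k" and F: "is_partition F"
  shows "(of_nat N - 1) * gauss_moment N (add_mset k F)
      + (\<Sum>a\<in>{1..<k}. gauss_moment N (add_mset a (add_mset (k - a) F)))
      + (\<Sum>m\<in>#F. of_nat m * gauss_moment N (add_mset (k + m) (F - {#m#})))
    = (\<Sum>a\<in>{1..<k}. gauss_moment N (add_mset (nat_dist a (k - a)) F))
      + (\<Sum>m\<in>#F. of_nat m * gauss_moment N (add_mset (nat_dist k m) (F - {#m#})))"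
proof -
  define L where "L = \<Sum>\<^sub># F"
  define M where "M = gauss_moment N"
  define e where "e = gauss_mean N"
  define D where "D m = of_nat m * of_nat (count F m) * M (F - {#m#})" for m
  define h where "h m = of_bool (even (k + m)) * D m" for m
  define H where "H = (\<Sum>m\<in>{1..<k}. h m)"
  define X where "X = (\<Sum>m\<in>{1..<k}. of_nat m * of_nat (count F m) * M (add_mset (k - m) (F - {#m#})))"
  define Y where "Y = (\<Sum>j\<in>{1..L}. of_nat j * of_nat (count F j) * of_nat (k + j)
    * of_nat (count F (k + j)) * M (F - {#j#} - {#k + j#}))"
  note stein = gauss_moment_add_mset[of N, folded M_def e_def]
  have e: "e j = of_bool (even j)" if "0 < j" for j
    using that by (simp add: e_def gauss_mean_def)
  have D_large: "D m = 0" if "L < m" for m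
    using set_mset_partition_subset[OF F] that by (auto simp: D_def L_def count_eq_zero_iff)
  have h_k: "h k = D k" by (simp add: h_def)

  have lhs1: "M (add_mset k F) = e k * M F + D k"
    by (simp add: stein D_def)
  have "M (add_mset a (add_mset (k - a) F)) =
      e a * e (k - a) * M F + e a * D (k - a) + of_nat a * of_nat (count F a) * M (add_mset (k - a) (F - {#a#}))
      + (if a = k - a then of_nat a else 0) * M F" for a
    unfolding stein[of a] mult.assoc[of "of_nat a"] count_add_mset_diff
    by (simp add: stein[of "k - a"] D_def algebra_simps)
  hence "(\<Sum>a\<in>{1..<k}. M (add_mset a (add_mset (k - a) F))) =
      (\<Sum>a\<in>{1..<k}. e a * e (k - a)) * M F + (\<Sum>a\<in>{1..<k}. e a * D (k - a)) + X
      + (\<Sum>a\<in>{1..<k}. if a = k - a then of_nat a else 0) * M F"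
    by (simp only: sum.distrib sum_distrib_right X_def)
  also have "(\<Sum>a\<in>{1..<k}. e a * D (k - a)) = H"
    unfolding H_def
    by (rule sum.reindex_bij_witness[of _ "\<lambda>m. k - m" "\<lambda>m. k - m"]) (auto simp: h_def e)
  finally have lhs2: "(\<Sum>a\<in>{1..<k}. M (add_mset a (add_mset (k - a) F))) =
      (\<Sum>a\<in>{1..<k}. e a * e (k - a)) * M F + H + X
      + (\<Sum>a\<in>{1..<k}. if a = k - a then of_nat a else 0) * M F" .

  have "(\<Sum>m\<in>#F. of_nat m * M (add_mset (k + m) (F - {#m#}))) =
      (\<Sum>j\<in>{1..L}. of_nat j * of_nat (count F j) * M (add_mset (k + j) (F - {#j#})))"
    by (rule sum_mset_partition) (use F L_def in auto)
  also have "\<dots> = (\<Sum>j\<in>{1..L}. h j) + Y"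
    unfolding Y_def sum.distrib[symmetric]
    by (intro sum.cong) (use assms(1) in \<open>auto simp: stein h_def e D_def algebra_simps\<close>)
  also have "(\<Sum>j\<in>{1..L}. h j) = (\<Sum>j\<in>{1..k + L}. h j)"
    by (rule sum.mono_neutral_left) (auto simp: h_def D_large)
  also have "\<dots> = H + D k + (\<Sum>j\<in>{1..L}. h (k + j))"
    by (simp only: sum_split_at[OF assms(1)] H_def h_k)
  finally have lhs3: "(\<Sum>m\<in>#F. of_nat m * M (add_mset (k + m) (F - {#m#}))) =
    H + D k + (\<Sum>j\<in>{1..L}. h (k + j)) + Y" .

  have "(\<Sum>a\<in>{1..<k}. M (add_mset (nat_dist a (k - a)) F)) =
      (\<Sum>a\<in>{1..<k}. e (nat_dist a (k - a))) * M F + (\<Sum>a\<in>{1..<k}. D (nat_dist a (k - a)))"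
    by (simp add: stein D_def sum.distrib sum_distrib_right)
  also have "(\<Sum>a\<in>{1..<k}. D (nat_dist a (k - a))) = 2 * H"
    unfolding H_def h_def by (rule sum_nat_dist_eq) (simp add: D_def)
  finally have rhs1: "(\<Sum>a\<in>{1..<k}. M (add_mset (nat_dist a (k - a)) F)) =
    (\<Sum>a\<in>{1..<k}. e (nat_dist a (k - a))) * M F + 2 * H" .

  have "(\<Sum>m\<in>#F. of_nat m * M (add_mset (nat_dist k m) (F - {#m#}))) =
      (\<Sum>m\<in>{1..k + L}. of_nat m * of_nat (count F m) * M (add_mset (nat_dist k m) (F - {#m#})))"
    by (rule sum_mset_partition) (use F L_def in auto)
  also have "\<dots> = X + of_nat N * D k +
      (\<Sum>j\<in>{1..L}. of_nat (k + j) * of_nat (count F (k + j)) * M (add_mset j (F - {#k + j#})))"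
  proof -
    have "(\<Sum>m\<in>{1..<k}. of_nat m * of_nat (count F m) * M (add_mset (nat_dist k m) (F - {#m#}))) = X"
      unfolding X_def by (intro sum.cong) (auto simp: nat_dist_def)
    moreover have "of_nat k * of_nat (count F k) * M (add_mset (nat_dist k k) (F - {#k#})) = of_nat N * D k"
      by (simp add: nat_dist_def stein D_def e_def gauss_mean_def)
    ultimately show ?thesis
      unfolding sum_split_at[OF assms(1)] by (simp add: nat_dist_def)
  qed
  also have "(\<Sum>j\<in>{1..L}. of_nat (k + j) * of_nat (count F (k + j)) * M (add_mset j (F - {#k + j#})))
      = (\<Sum>j\<in>{1..L}. h (k + j)) + Y"
    unfolding Y_def sum.distrib[symmetric]
    by (intro sum.cong) (use assms(1) in \<open>auto simp: stein h_def e D_def algebra_simps add_mset_commute\<close>)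
  finally have rhs2: "(\<Sum>m\<in>#F. of_nat m * M (add_mset (nat_dist k m) (F - {#m#}))) =
    X + of_nat N * D k + ((\<Sum>j\<in>{1..L}. h (k + j)) + Y)" .

  show ?thesis
    unfolding M_def[symmetric] lhs1 lhs2 lhs3 rhs1 rhs2
      gauss_mean_convolution[OF assms(1), of N, folded e_def, symmetric]
    by (simp add: algebra_simps)
qed

definition power_sum_pairing :: "nat multiset \<Rightarrow> nat multiset \<Rightarrow> complex" where
  "power_sum_pairing F G =
    (if F = G then (\<Prod>j\<in>set_mset F. of_nat (j ^ count F j * fact (count F j))) else 0)"

lemma power_sum_pairing_sym: "power_sum_pairing F G = power_sum_pairing G F"
  by (simp add: power_sum_pairing_def)

lemma power_sum_pairing_empty [simp]: "power_sum_pairing {#} {#} = 1"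
  by (simp add: power_sum_pairing_def)

lemma power_sum_pairing_add_mset:
  "power_sum_pairing (add_mset k F) G = of_nat k * of_nat (count G k) * power_sum_pairing F (G - {#k#})"
proof (cases "add_mset k F = G")
  case True
  let ?z = "\<lambda>F j. of_nat (j ^ count F j * fact (count F j)) :: complex"
  let ?r = "\<Prod>j\<in>set_mset F - {k}. ?z F j"
  have sup: "(\<Prod>j\<in>set_mset H. ?z H j) = ?z H k * (\<Prod>j\<in>set_mset F - {k}. ?z H j)"
    if "set_mset H \<subseteq> insert k (set_mset F)" for H
  proof -
    have "(\<Prod>j\<in>set_mset H. ?z H j) = (\<Prod>j\<in>insert k (set_mset F). ?z H j)"
      by (rule prod.mono_neutral_left) (use that in \<open>auto simp: not_in_iff\<close>)
    thus ?thesis by (subst (asm) prod.insert_remove) auto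
  qed
  have "(\<Prod>j\<in>set_mset G. ?z G j) = ?z G k * ?r"
    by (subst sup) (auto simp flip: True)
  moreover have "(\<Prod>j\<in>set_mset F. ?z F j) = ?z F k * ?r"
    by (subst sup) auto
  moreover have "?z G k = of_nat k * of_nat (count G k) * ?z F k"
    by (simp add: algebra_simps flip: True)
  moreover have "G - {#k#} = F" by (simp flip: True)
  ultimately show ?thesis
    using True by (simp only: power_sum_pairing_def if_True mult.assoc simp_thms)
next
  case False
  hence "k \<notin># G \<or> F \<noteq> G - {#k#}" by auto
  thus ?thesis using False by (auto simp: power_sum_pairing_def not_in_iff)
qed

lemma power_sum_pairing_add_mset_right:
  "power_sum_pairing F (add_mset k G) = of_nat k * of_nat (count F k) * power_sum_pairing (F - {#k#}) G"
  using power_sum_pairing_add_mset[of k G F] by (simp only: power_sum_pairing_sym)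

lemma power_sum_pairing_loop_equation:
  fixes c :: complex
  assumes "0 < k" and F: "is_partition F" and G: "is_partition G"
  shows "c * power_sum_pairing (add_mset k F) G
      + (\<Sum>a\<in>{1..<k}. power_sum_pairing (add_mset a (add_mset (k - a) F)) G)
      + (\<Sum>m\<in>#F. of_nat m * power_sum_pairing (add_mset (k + m) (F - {#m#})) G)
    = (\<Sum>m\<in>#G. of_nat m * (if m < k then power_sum_pairing (add_mset (k - m) F) (G - {#m#})
        else if m = k then c * power_sum_pairing F (G - {#m#})
        else power_sum_pairing F (add_mset (m - k) (G - {#m#}))))"
proof -
  define L where "L = \<Sum>\<^sub># F + \<Sum>\<^sub># G"
  let ?T = power_sum_pairing
  have 1: "(\<Sum>a\<in>{1..<k}. ?T (add_mset a (add_mset (k - a) F)) G)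
      = (\<Sum>a\<in>{1..<k}. of_nat a * of_nat (count G a) * ?T (add_mset (k - a) F) (G - {#a#}))"
    by (simp add: power_sum_pairing_add_mset[of _ "add_mset _ _"])
  have "(\<Sum>m\<in>#F. of_nat m * ?T (add_mset (k + m) (F - {#m#})) G) =
      (\<Sum>j\<in>{1..L}. of_nat j * of_nat (count F j) * ?T (add_mset (k + j) (F - {#j#})) G)"
    by (rule sum_mset_partition) (use F L_def in auto)
  also have "\<dots> = (\<Sum>j\<in>{1..L}. of_nat (k + j) * of_nat (count G (k + j)) * ?T F (add_mset j (G - {#k + j#})))"
    by (intro sum.cong) (simp_all add: power_sum_pairing_add_mset power_sum_pairing_add_mset_right)
  finally have 2: "(\<Sum>m\<in>#F. of_nat m * ?T (add_mset (k + m) (F - {#m#})) G) =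
    (\<Sum>j\<in>{1..L}. of_nat (k + j) * of_nat (count G (k + j)) * ?T F (add_mset j (G - {#k + j#})))" .
  show ?thesis
    unfolding 1 2 power_sum_pairing_add_mset[of k F]
    by (subst sum_mset_partition[where L = "k + L"])
       (use G \<open>0 < k\<close> in \<open>simp_all add: L_def sum_split_at[unfolded One_nat_def]\<close>)
qed

lemma gauss_moment_euler:
  assumes "is_partition F" "\<Sum>\<^sub># F \<le> L"
  shows "of_nat (\<Sum>\<^sub># F) * gauss_moment N F =
    (\<Sum>k\<in>{1..L}. of_nat k * of_nat (count F k) *
      (of_bool (even k) * gauss_moment N (F - {#k#})
       + of_nat k * of_nat (count (F - {#k#}) k) * gauss_moment N (F - {#k#} - {#k#})))"
proof -
  have "of_nat (\<Sum>\<^sub># F) = (\<Sum>k\<in>{1..L}. of_nat k * complex_of_nat (count F k))"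
    using sum_mset_partition[OF assms, of "\<lambda>_. 1"] by simp
  hence "of_nat (\<Sum>\<^sub># F) * gauss_moment N F = (\<Sum>k\<in>{1..L}. of_nat k * of_nat (count F k) * gauss_moment N F)"
    by (simp add: sum_distrib_right)
  also have "\<dots> = (\<Sum>k\<in>{1..L}. of_nat k * of_nat (count F k) *
      (of_bool (even k) * gauss_moment N (F - {#k#})
       + of_nat k * of_nat (count (F - {#k#}) k) * gauss_moment N (F - {#k#} - {#k#})))"
  proof (intro sum.cong refl)
    fix k assume k: "k \<in> {1..L}"
    show "of_nat k * of_nat (count F k) * gauss_moment N F = of_nat k * of_nat (count F k) *
      (of_bool (even k) * gauss_moment N (F - {#k#})
       + of_nat k * of_nat (count (F - {#k#}) k) * gauss_moment N (F - {#k#} - {#k#}))"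
    proof (cases "k \<in># F")
      case True
      hence "gauss_moment N F = gauss_moment N (add_mset k (F - {#k#}))" by simp
      thus ?thesis using k unfolding gauss_moment_add_mset by (simp add: gauss_mean_def)
    qed (simp add: not_in_iff)
  qed
  finally show ?thesis .
qed

lemma gauss_moment_odd:
  assumes "is_partition F" "odd (\<Sum>\<^sub># F)"
  shows "gauss_moment N F = 0"
  using assms
proof (induction "\<Sum>\<^sub># F" arbitrary: F rule: less_induct)
  case less
  have sum: "\<Sum>\<^sub># (F - {#k#}) + k = \<Sum>\<^sub># F" if "k \<in># F" for F :: "nat multiset" and k
    using sum_mset_remove1_eq[OF that] by simp
  have part: "is_partition (F - {#k#})" if "is_partition F" for F k
    using that by (auto simp: is_partition_def dest: in_diffD)
  have "of_nat (\<Sum>\<^sub># F) * gauss_moment N F = 0"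
    unfolding gauss_moment_euler[OF less.prems(1) order_refl]
  proof (intro sum.neutral ballI)
    fix k assume k: "k \<in> {1..\<Sum>\<^sub># F}"
    have "of_bool (even k) * gauss_moment N (F - {#k#}) = 0" if "k \<in># F"
    proof (cases "even k")
      case True
      have "odd (\<Sum>\<^sub># (F - {#k#}))" "\<Sum>\<^sub># (F - {#k#}) < \<Sum>\<^sub># F"
        using sum[OF that] k less.prems(2) True by presburger+
      thus ?thesis using less.hyps part[OF less.prems(1)] by simp
    qed simp
    moreover have "gauss_moment N (F - {#k#} - {#k#}) = 0" if "k \<in># F" "k \<in># F - {#k#}"
    proof -
      have "odd (\<Sum>\<^sub># (F - {#k#} - {#k#}))" "\<Sum>\<^sub># (F - {#k#} - {#k#}) < \<Sum>\<^sub># F"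
        using sum[OF that(1)] sum[OF that(2)] k less.prems(2) by presburger+
      thus ?thesis using less.hyps part[OF part[OF less.prems(1)]] by blast
    qed
    ultimately show "of_nat k * of_nat (count F k) *
      (of_bool (even k) * gauss_moment N (F - {#k#})
       + of_nat k * of_nat (count (F - {#k#}) k) * gauss_moment N (F - {#k#} - {#k#})) = 0"
      by (cases "k \<in># F"; cases "k \<in># F - {#k#}") (auto simp: not_in_iff)
  qed
  moreover have "\<Sum>\<^sub># F \<noteq> 0" using less.prems(2) by (intro notI) simp
  ultimately show ?case by (simp only: mult_eq_0_iff of_nat_eq_0_iff simp_thms)
qed

section \<open>Unitary matrices and derivatives along one-parameter groups\<close>

definition adj :: "complex ^ 'n ^ 'n \<Rightarrow> complex ^ 'n ^ 'n" where
  "adj U = map_matrix cnj (Finite_Cartesian_Product.transpose U)"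

lemma matrix_mult_nth: "(A ** B) $ i $ j = (\<Sum>k\<in>UNIV. A $ i $ k * B $ k $ j)"
  by (simp add: matrix_matrix_mult_def)

lemma mat_mult_nth: "(mat z ** B) $ i $ j = z * B $ i $ j"
proof -
  have "(mat z ** B) $ i $ j = (\<Sum>k\<in>UNIV. if k = i then z * B $ i $ j else 0)"
    unfolding matrix_mult_nth by (intro sum.cong) (auto simp: mat_def)
  thus ?thesis by simp
qed

lemma matrix_mult_sum_distrib: "A ** (\<Sum>x\<in>S. f x) = (\<Sum>x\<in>S. A ** f x)"
  by (auto simp: vec_eq_iff matrix_mult_nth sum_component sum_distrib_left intro: sum.swap)

lemma matrix_power_0 [simp]: "matrix_power A 0 = mat 1"
  by (simp add: matrix_power_def)

lemma matrix_power_Suc: "matrix_power A (Suc k) = A ** matrix_power A k"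
  by (simp add: matrix_power_def)

lemma matrix_power_add: "matrix_power A (a + b) = matrix_power A a ** matrix_power A b"
  by (induction a) (simp_all add: matrix_power_Suc matrix_mul_assoc)

lemma matrix_power_Suc': "matrix_power A (Suc k) = matrix_power A k ** A"
  using matrix_power_add[of A k 1] by (simp add: matrix_power_Suc)

lemma adj_nth: "adj A $ i $ j = cnj (A $ j $ i)"
  by (simp add: adj_def Finite_Cartesian_Product.transpose_def)

lemma adj_mat_1: "adj (mat 1) = mat 1"
  by (auto simp: vec_eq_iff adj_nth mat_def)

lemma adj_mat: "adj (mat z) = mat (cnj z)"
  by (auto simp: vec_eq_iff adj_nth mat_def)

lemma adj_mult: "adj (A ** B) = adj B ** adj A"
  by (simp add: vec_eq_iff adj_nth matrix_mult_nth mult.commute)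

lemma adj_matrix_power: "adj (matrix_power A k) = matrix_power (adj A) k"
proof (induction k)
  case (Suc k)
  show ?case by (simp only: matrix_power_Suc[of A] adj_mult Suc matrix_power_Suc'[of "adj A"])
qed (simp add: adj_mat_1)

lemma trace_adj: "trace (adj A) = cnj (trace A)"
  by (simp add: trace_def adj_nth)

lemma trace_mult: "trace (A ** B) = (\<Sum>i\<in>UNIV. \<Sum>j\<in>UNIV. A $ i $ j * B $ j $ i)"
  by (simp add: trace_def matrix_mult_nth)

lemma trace_mult_transpose:
  "trace (A ** Finite_Cartesian_Product.transpose B) = (\<Sum>i\<in>UNIV. \<Sum>j\<in>UNIV. A $ i $ j * B $ i $ j)"
  by (simp add: trace_mult Finite_Cartesian_Product.transpose_def)

lemma in_unitary_group: "U \<in> unitary_group \<longleftrightarrow> adj U ** U = mat 1 \<and> U ** adj U = mat 1"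
  by (simp add: unitary_group_def adj_def)

lemma unitary_group_mult:
  assumes "U \<in> unitary_group" "V \<in> unitary_group"
  shows "U ** V \<in> unitary_group"
proof -
  have "adj V ** adj U ** (U ** V) = adj V ** (adj U ** U) ** V"
    "U ** V ** (adj V ** adj U) = U ** (V ** adj V) ** adj U"
    by (simp_all only: matrix_mul_assoc)
  thus ?thesis using assms by (simp add: in_unitary_group adj_mult)
qed

lemma power_mult_adj_power:
  assumes "U \<in> unitary_group"
  shows "matrix_power U k ** matrix_power (adj U) m =
    (if m \<le> k then matrix_power U (k - m) else matrix_power (adj U) (m - k))"
proof -
  have 1: "matrix_power U m ** matrix_power (adj U) m = mat 1" for m
  proof (induction m)
    case (Suc m)
    have "matrix_power U (Suc m) ** matrix_power (adj U) (Suc m) =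
        U ** (matrix_power U m ** matrix_power (adj U) m) ** adj U"
      by (simp only: matrix_power_Suc[of U] matrix_power_Suc'[of "adj U"] matrix_mul_assoc)
    thus ?case using Suc assms by (simp add: in_unitary_group)
  qed simp
  show ?thesis
  proof (cases "m \<le> k")
    case True
    hence "matrix_power U k = matrix_power U (k - m) ** matrix_power U m"
      by (simp flip: matrix_power_add)
    thus ?thesis using True by (simp add: 1 flip: matrix_mul_assoc)
  next
    case False
    hence "matrix_power (adj U) m = matrix_power (adj U) k ** matrix_power (adj U) (m - k)"
      by (simp flip: matrix_power_add)
    thus ?thesis using False by (simp add: 1 matrix_mul_assoc)
  qed
qed

lemma trace_power_mult_adj_power:
  assumes "U \<in> unitary_group"
  shows "trace (matrix_power U k ** matrix_power (adj U) m) =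
    (if m \<le> k then trace (matrix_power U (k - m)) else cnj (trace (matrix_power U (m - k))))"
  by (simp add: power_mult_adj_power[OF assms] flip: trace_adj, simp add: adj_matrix_power)

lemma norm_unitary_nth_le_1:
  assumes "U \<in> unitary_group"
  shows "norm (U $ i $ j) \<le> 1"
proof -
  have "(\<Sum>k\<in>UNIV. U $ i $ k * cnj (U $ i $ k)) = 1"
    using assms by (simp add: in_unitary_group vec_eq_iff matrix_mult_nth adj_nth mat_def)
  hence "(\<Sum>k\<in>UNIV. complex_of_real ((norm (U $ i $ k))\<^sup>2)) = 1"
    by (simp only: complex_norm_square)
  hence "(\<Sum>k\<in>UNIV. (norm (U $ i $ k))\<^sup>2) = 1"
    by (metis of_real_eq_1_iff of_real_sum)
  moreover have "(norm (U $ i $ j))\<^sup>2 \<le> (\<Sum>k\<in>UNIV. (norm (U $ i $ k))\<^sup>2)"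
    by (rule member_le_sum) auto
  ultimately show ?thesis by (simp add: abs_square_le_1)
qed

lemma unitary_matrix_power: "U \<in> unitary_group \<Longrightarrow> matrix_power U k \<in> unitary_group"
  by (induction k) (simp_all add: matrix_power_Suc unitary_group_mult, simp add: in_unitary_group adj_mat_1)

lemma continuous_on_matrix_mult:
  fixes f g :: "'a::topological_space \<Rightarrow> complex ^ 'n ^ 'n"
  assumes "continuous_on S f" "continuous_on S g"
  shows "continuous_on S (\<lambda>x. f x ** g x)"
  unfolding matrix_matrix_mult_def
  by (intro continuous_on_vec_lambda continuous_on_sum continuous_on_mult continuous_on_component assms)

lemma continuous_on_matrix_power:
  fixes f :: "'a::topological_space \<Rightarrow> complex ^ 'n ^ 'n"
  assumes "continuous_on S f"
  shows "continuous_on S (\<lambda>x. matrix_power (f x) k)"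
  by (induction k) (simp_all add: matrix_power_Suc continuous_on_matrix_mult assms)

lemma continuous_on_adj:
  fixes f :: "'a::topological_space \<Rightarrow> complex ^ 'n ^ 'n"
  assumes "continuous_on S f"
  shows "continuous_on S (\<lambda>x. adj (f x))"
  unfolding adj_def map_matrix_def Finite_Cartesian_Product.transpose_def
  by (simp, intro continuous_on_vec_lambda continuous_on_cnj continuous_on_component assms)

lemma continuous_on_trace:
  fixes f :: "'a::topological_space \<Rightarrow> complex ^ 'n ^ 'n"
  assumes "continuous_on S f"
  shows "continuous_on S (\<lambda>x. trace (f x))"
  unfolding trace_def by (intro continuous_on_sum continuous_on_component assms)

lemma power_sum_trace_eq_prod_mset:
  "power_sum_trace F U = (\<Prod>j\<in>#F. trace (matrix_power U j))"
  by (simp add: power_sum_trace_def image_prod_mset_multiplicity)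

lemma power_sum_trace_empty [simp]: "power_sum_trace {#} U = 1"
  by (simp add: power_sum_trace_eq_prod_mset)

lemma power_sum_trace_add_mset [simp]:
  "power_sum_trace (add_mset j F) U = trace (matrix_power U j) * power_sum_trace F U"
  by (simp add: power_sum_trace_eq_prod_mset)

lemma continuous_on_power_sum_trace:
  fixes f :: "'a::topological_space \<Rightarrow> complex ^ 'n ^ 'n"
  assumes "continuous_on S f"
  shows "continuous_on S (\<lambda>x. power_sum_trace F (f x))"
  by (induction F) (auto intro!: continuous_intros continuous_on_trace continuous_on_matrix_power assms)

lemma continuous_on_sum_mset:
  fixes f :: "'i \<Rightarrow> 'a::topological_space \<Rightarrow> complex"
  assumes "\<And>i. continuous_on S (f i)"
  shows "continuous_on S (\<lambda>x. \<Sum>i\<in>#F. f i x)"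
  by (induction F) (auto intro!: continuous_intros assms)

lemmas matrix_continuous_intros =
  continuous_intros continuous_on_component continuous_on_matrix_mult continuous_on_matrix_power
  continuous_on_adj continuous_on_trace continuous_on_power_sum_trace continuous_on_sum_mset

lemma compact_unitary_group: "compact (unitary_group :: (complex ^ 'n ^ 'n) set)"
proof -
  have "closed ({U. adj U ** U = mat 1} \<inter> {U. U ** adj U = (mat 1 :: complex ^ 'n ^ 'n)})"
    by (intro closed_Int closed_Collect_eq matrix_continuous_intros)
  also have "{U. adj U ** U = mat 1} \<inter> {U. U ** adj U = (mat 1 :: complex ^ 'n ^ 'n)} = unitary_group"
    by (auto simp: in_unitary_group)
  finally have "closed (unitary_group :: (complex ^ 'n ^ 'n) set)" .
  moreover have "norm U \<le> (\<Sum>i\<in>(UNIV :: 'n set). \<Sum>j\<in>(UNIV :: 'n set). 1)" if "U \<in> unitary_group" for U :: "complex ^ 'n ^ 'n"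
  proof -
    have "norm U \<le> (\<Sum>i\<in>UNIV. norm (U $ i))"
      unfolding norm_vec_def by (rule L2_set_le_sum) simp
    also have "\<dots> \<le> (\<Sum>i\<in>UNIV. \<Sum>j\<in>UNIV. norm (U $ i $ j))"
      unfolding norm_vec_def[of "U $ _"] by (intro sum_mono L2_set_le_sum) simp
    also have "\<dots> \<le> (\<Sum>i\<in>(UNIV :: 'n set). \<Sum>j\<in>(UNIV :: 'n set). 1)"
      using norm_unitary_nth_le_1[OF that] by (intro sum_mono) auto
    finally show ?thesis .
  qed
  ultimately show ?thesis
    by (auto simp: compact_eq_bounded_closed bounded_iff)
qed

text \<open>
  This is the one-parameter group \<open>exp (t A)\<close> of a generator with \<open>A\<^sup>3 = - A\<close>.
\<close>

definition rotation :: "complex ^ 'n ^ 'n \<Rightarrow> real \<Rightarrow> complex ^ 'n ^ 'n" where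
  "rotation A t = mat 1 + sin t *\<^sub>R A + (1 - cos t) *\<^sub>R (A ** A)"

lemma rotation_0 [simp]: "rotation A 0 = mat 1"
  by (simp add: rotation_def)

lemma rotation_add:
  assumes "A ** A ** A = - A"
  shows "rotation A (s + t) = rotation A s ** rotation A t"
proof -
  have 3: "A ** (A ** A) = - A" using assms by (simp add: matrix_mul_assoc)
  have 4: "A ** A ** (A ** A) = - (A ** A)"
  proof -
    have "A ** A ** (A ** A) = A ** A ** A ** A" by (simp only: matrix_mul_assoc)
    also have "\<dots> = - (A ** A)" unfolding assms by (simp add: vec_eq_iff matrix_mult_nth sum_negf)
    finally show ?thesis .
  qed
  have scale: "(a *\<^sub>R X) ** (b *\<^sub>R Y) = (a * b) *\<^sub>R (X ** Y)" for a b and X Y :: "complex ^ 'n ^ 'n"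
    by (simp add: vec_eq_iff matrix_mult_nth scaleR_sum_right mult.commute)
  have scale': "(a *\<^sub>R X) ** Y = a *\<^sub>R (X ** Y)" "X ** (a *\<^sub>R Y) = a *\<^sub>R (X ** Y)"
    for a and X Y :: "complex ^ 'n ^ 'n"
    using scale[of a X 1 Y] scale[of 1 X a Y] by simp_all
  have rdistrib: "(X + Y) ** Z = X ** Z + Y ** Z" for X Y Z :: "complex ^ 'n ^ 'n"
    by (simp add: vec_eq_iff matrix_mult_nth distrib_right sum.distrib)
  have expand: "(mat 1 + a *\<^sub>R A + b *\<^sub>R (A ** A)) ** (mat 1 + c *\<^sub>R A + d *\<^sub>R (A ** A)) =
      mat 1 + (a + c - a * d - b * c) *\<^sub>R A + (a * c + b + d - b * d) *\<^sub>R (A ** A)" for a b c d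
  proof -
    have "(mat 1 + a *\<^sub>R A + b *\<^sub>R (A ** A)) ** (mat 1 + c *\<^sub>R A + d *\<^sub>R (A ** A)) =
        mat 1 + c *\<^sub>R A + d *\<^sub>R (A ** A) + a *\<^sub>R A + (a * c) *\<^sub>R (A ** A) + (a * d) *\<^sub>R (A ** (A ** A))
        + b *\<^sub>R (A ** A) + (b * c) *\<^sub>R (A ** A ** A) + (b * d) *\<^sub>R (A ** A ** (A ** A))"
      by (simp only: matrix_add_ldistrib rdistrib scale scale' matrix_mul_lid matrix_mul_rid
          scaleR_add_right scaleR_scaleR mult.commute add_ac)
    thus ?thesis unfolding 3 4 assms by (simp add: vec_eq_iff algebra_simps)
  qed
  have "rotation A s ** rotation A t = mat 1 + (sin s + sin t - sin s * (1 - cos t) - (1 - cos s) * sin t) *\<^sub>R A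
     + (sin s * sin t + (1 - cos s) + (1 - cos t) - (1 - cos s) * (1 - cos t)) *\<^sub>R (A ** A)"
    unfolding rotation_def by (rule expand)
  also have "\<dots> = rotation A (s + t)"
    unfolding rotation_def sin_add cos_add
    by (intro arg_cong2[of _ _ _ _ "(+)"] arg_cong2[of _ _ _ _ "(*\<^sub>R)"] refl) (simp_all add: algebra_simps)
  finally show ?thesis by simp
qed

lemma rotation_unitary:
  assumes "A ** A ** A = - A" "adj A = - A"
  shows "rotation A t \<in> unitary_group"
proof -
  have "adj (A ** A) = A ** A"
    unfolding adj_mult assms(2) by (simp add: vec_eq_iff matrix_mult_nth)
  hence *: "cnj ((A ** A) $ j $ i) = (A ** A) $ i $ j" "cnj (A $ j $ i) = - (A $ i $ j)" for i j
    using assms(2) by (metis adj_nth, metis adj_nth vector_uminus_component)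
  have "adj (rotation A t) = rotation A (- t)"
    by (auto simp: vec_eq_iff adj_nth rotation_def * mat_def)
  thus ?thesis
    using rotation_add[OF assms(1), of t "- t"] rotation_add[OF assms(1), of "- t" t]
    by (simp add: in_unitary_group)
qed

definition has_entry_derivative ::
    "(real \<Rightarrow> complex ^ 'n ^ 'n) \<Rightarrow> complex ^ 'n ^ 'n \<Rightarrow> bool" where
  "has_entry_derivative \<gamma> B \<longleftrightarrow>
    (\<forall>i j. ((\<lambda>t. \<gamma> t $ i $ j) has_vector_derivative B $ i $ j) (at 0))"

lemma has_entry_derivative_mult:
  assumes "has_entry_derivative \<gamma> B" "has_entry_derivative \<delta> C"
  shows "has_entry_derivative (\<lambda>t. \<gamma> t ** \<delta> t) (B ** \<delta> 0 + \<gamma> 0 ** C)"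
  using assms unfolding has_entry_derivative_def matrix_mult_nth vector_add_component
  by (auto intro!: derivative_eq_intros simp: sum.distrib)

lemma has_entry_derivative_const: "has_entry_derivative (\<lambda>t. A) 0"
  by (simp add: has_entry_derivative_def)

lemma has_entry_derivative_rotation: "has_entry_derivative (rotation A) A"
  unfolding has_entry_derivative_def rotation_def
  by (auto intro!: derivative_eq_intros)

lemma has_entry_derivative_power:
  assumes "has_entry_derivative \<gamma> (A ** U)" "\<gamma> 0 = U"
  shows "has_entry_derivative (\<lambda>t. matrix_power (\<gamma> t) k)
    (\<Sum>a<k. matrix_power U a ** A ** matrix_power U (k - a))"
proof (induction k)
  case (Suc k)
  have "A ** U ** matrix_power U k + U ** (\<Sum>a<k. matrix_power U a ** A ** matrix_power U (k - a))
    = (\<Sum>a<Suc k. matrix_power U a ** A ** matrix_power U (Suc k - a))"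
  proof -
    have "U ** (\<Sum>a<k. matrix_power U a ** A ** matrix_power U (k - a)) =
      (\<Sum>a<k. matrix_power U (Suc a) ** A ** matrix_power U (k - a))"
      by (simp add: matrix_mult_sum_distrib matrix_power_Suc matrix_mul_assoc)
    thus ?thesis
      unfolding sum.lessThan_Suc_shift by (simp add: matrix_power_Suc matrix_mul_assoc)
  qed
  thus ?case
    using has_entry_derivative_mult[OF assms(1) Suc] by (simp add: assms(2) matrix_power_Suc)
qed (simp add: has_entry_derivative_const)

lemma has_vector_derivative_trace_power:
  assumes "has_entry_derivative \<gamma> (A ** U)" "\<gamma> 0 = U"
  shows "((\<lambda>t. trace (matrix_power (\<gamma> t) m)) has_vector_derivative
    of_nat m * trace (A ** matrix_power U m)) (at 0)"
proof -
  have "((\<lambda>t. trace (matrix_power (\<gamma> t) m)) has_vector_derivative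
      trace (\<Sum>a<m. matrix_power U a ** A ** matrix_power U (m - a))) (at 0)"
    using has_entry_derivative_power[OF assms, of m]
    unfolding has_entry_derivative_def trace_def
    by (intro has_vector_derivative_sum) auto
  moreover have "trace (\<Sum>a<m. matrix_power U a ** A ** matrix_power U (m - a))
      = (\<Sum>a<m. trace (matrix_power U a ** A ** matrix_power U (m - a)))"
    by (simp add: trace_def sum_component sum.swap[of _ "{..<m}"])
  moreover have "trace (matrix_power U a ** A ** matrix_power U (m - a)) = trace (A ** matrix_power U m)"
    if "a < m" for a
  proof -
    have "trace (matrix_power U a ** A ** matrix_power U (m - a)) =
        trace (A ** matrix_power U (m - a) ** matrix_power U a)"
      by (metis trace_mul_sym matrix_mul_assoc)
    thus ?thesis using that by (simp flip: matrix_mul_assoc matrix_power_add)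
  qed
  ultimately show ?thesis by simp
qed

lemma has_vector_derivative_power_sum_trace:
  assumes "has_entry_derivative \<gamma> (A ** U)" "\<gamma> 0 = U"
  shows "((\<lambda>t. power_sum_trace F (\<gamma> t)) has_vector_derivative
    (\<Sum>m\<in>#F. of_nat m * trace (A ** matrix_power U m) * power_sum_trace (F - {#m#}) U)) (at 0)"
proof (induction F)
  case (add x F)
  have "(\<Sum>m\<in>#F. of_nat m * trace (A ** matrix_power U m) * power_sum_trace (add_mset x F - {#m#}) U)
    = (\<Sum>m\<in>#F. trace (matrix_power U x) *
        (of_nat m * trace (A ** matrix_power U m) * power_sum_trace (F - {#m#}) U))"
    by (intro arg_cong[of _ _ sum_mset] image_mset_cong) (simp add: algebra_simps)
  thus ?case
    using has_vector_derivative_mult[OF has_vector_derivative_trace_power[OF assms, of x] add]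
    by (simp add: assms(2) sum_mset_distrib_left algebra_simps)
qed simp



text \<open>
  The derivative of \<open>U\<^sup>k\<^sub>i\<^sub>j p\<^sub>F(U) cnj (p\<^sub>G(U))\<close> along \<open>U \<mapsto> exp (t E\<^sub>p\<^sub>q) U\<close>, extended complex linearly from
  skew-Hermitian directions; hence the sign of the last term.
\<close>

definition loop_density ::
    "nat \<Rightarrow> 'n \<Rightarrow> 'n \<Rightarrow> nat multiset \<Rightarrow> nat multiset \<Rightarrow> 'n \<Rightarrow> 'n \<Rightarrow> complex ^ 'n ^ 'n \<Rightarrow> complex" where
  "loop_density k i j F G p q U =
    (\<Sum>a<k. matrix_power U a $ i $ p * matrix_power U (k - a) $ q $ j)
      * power_sum_trace F U * cnj (power_sum_trace G U)
    + matrix_power U k $ i $ j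
      * (\<Sum>m\<in>#F. of_nat m * matrix_power U m $ q $ p * power_sum_trace (F - {#m#}) U)
      * cnj (power_sum_trace G U)
    - matrix_power U k $ i $ j * power_sum_trace F U
      * (\<Sum>m\<in>#G. of_nat m * matrix_power (adj U) m $ q $ p * cnj (power_sum_trace (G - {#m#}) U))"

lemma continuous_on_loop_density: "continuous_on S (loop_density k i j F G p q)"
  unfolding loop_density_def by (intro matrix_continuous_intros)

lemma cnj_sum_mset: "cnj (\<Sum>m\<in>#F. f m) = (\<Sum>m\<in>#F. cnj (f m))"
  by (induction F) auto

lemma sum_mset_negf: "(\<Sum>m\<in>#F. - f m) = - (\<Sum>m\<in>#F. f m)" for f :: "'a \<Rightarrow> complex"
  by (induction F) auto

lemma sum_sum_mset_swap: "(\<Sum>x\<in>S. \<Sum>m\<in>#F. f x m) = (\<Sum>m\<in>#F. \<Sum>x\<in>S. f x m)"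
  for f :: "'a \<Rightarrow> 'b \<Rightarrow> complex"
  by (induction F) (auto simp: sum.distrib)

lemma has_vector_derivative_loop_test_function:
  assumes A: "adj A = - A" and \<gamma>: "has_entry_derivative \<gamma> (A ** U)" "\<gamma> 0 = U"
  shows "((\<lambda>t. matrix_power (\<gamma> t) k $ i $ j * power_sum_trace F (\<gamma> t) * cnj (power_sum_trace G (\<gamma> t)))
    has_vector_derivative (\<Sum>p\<in>UNIV. \<Sum>q\<in>UNIV. A $ p $ q * loop_density k i j F G p q U)) (at 0)"
proof -
  let ?P = "\<lambda>k. matrix_power U k"
  let ?f = "power_sum_trace F U" and ?g = "cnj (power_sum_trace G U)"
  let ?dk = "\<Sum>a<k. ?P a ** A ** ?P (k - a)"
  let ?dF = "\<Sum>m\<in>#F. of_nat m * trace (A ** ?P m) * power_sum_trace (F - {#m#}) U"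
  let ?dG = "\<Sum>m\<in>#G. of_nat m * trace (A ** ?P m) * power_sum_trace (G - {#m#}) U"
  have 1: "((\<lambda>t. matrix_power (\<gamma> t) k $ i $ j) has_vector_derivative ?dk $ i $ j) (at 0)"
    using has_entry_derivative_power[OF \<gamma>] unfolding has_entry_derivative_def by blast
  have deriv: "((\<lambda>t. matrix_power (\<gamma> t) k $ i $ j * power_sum_trace F (\<gamma> t) * cnj (power_sum_trace G (\<gamma> t)))
    has_vector_derivative ?dk $ i $ j * ?f * ?g + ?P k $ i $ j * ?dF * ?g + ?P k $ i $ j * ?f * cnj ?dG) (at 0)"
    by (rule derivative_eq_intros has_vector_derivative_power_sum_trace[OF \<gamma>] 1 refl)+
       (simp add: \<gamma>(2) algebra_simps)
  have dk: "?dk $ i $ j = (\<Sum>p\<in>UNIV. \<Sum>q\<in>UNIV. A $ p $ q * (\<Sum>a<k. ?P a $ i $ p * ?P (k - a) $ q $ j))"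
  proof -
    have "?dk $ i $ j = (\<Sum>a<k. \<Sum>q\<in>UNIV. \<Sum>p\<in>UNIV. A $ p $ q * (?P a $ i $ p * ?P (k - a) $ q $ j))"
      by (simp add: sum_component matrix_mult_nth sum_distrib_left sum_distrib_right mult_ac)
    also have "\<dots> = (\<Sum>a<k. \<Sum>p\<in>UNIV. \<Sum>q\<in>UNIV. A $ p $ q * (?P a $ i $ p * ?P (k - a) $ q $ j))"
      by (intro sum.cong sum.swap refl)
    also have "\<dots> = (\<Sum>p\<in>UNIV. \<Sum>q\<in>UNIV. \<Sum>a<k. A $ p $ q * (?P a $ i $ p * ?P (k - a) $ q $ j))"
      by (simp only: sum.swap[of _ "{..<k}"])
    finally show ?thesis by (simp only: sum_distrib_left)
  qed
  have dF: "?dF = (\<Sum>p\<in>UNIV. \<Sum>q\<in>UNIV. A $ p $ q *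
      (\<Sum>m\<in>#F. of_nat m * ?P m $ q $ p * power_sum_trace (F - {#m#}) U))"
    by (simp add: trace_mult sum_mset_distrib_left sum_sum_mset_swap sum_distrib_left sum_distrib_right mult_ac)
  have tr: "cnj (trace (A ** ?P m)) = - trace (A ** matrix_power (adj U) m)" for m
  proof -
    have "cnj (trace (A ** ?P m)) = trace (matrix_power (adj U) m ** (- A))"
      by (simp flip: trace_adj add: adj_mult adj_matrix_power A)
    also have "\<dots> = - trace (A ** matrix_power (adj U) m)"
      by (subst trace_mul_sym) (simp add: trace_def matrix_mult_nth sum_negf)
    finally show ?thesis .
  qed
  have dG: "cnj ?dG = - (\<Sum>p\<in>UNIV. \<Sum>q\<in>UNIV. A $ p $ q *
      (\<Sum>m\<in>#G. of_nat m * matrix_power (adj U) m $ q $ p * cnj (power_sum_trace (G - {#m#}) U)))"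
  proof -
    have "cnj ?dG = (\<Sum>m\<in>#G. - (of_nat m * trace (A ** matrix_power (adj U) m) * cnj (power_sum_trace (G - {#m#}) U)))"
      by (simp add: cnj_sum_mset tr)
    also have "\<dots> = - (\<Sum>m\<in>#G. of_nat m * trace (A ** matrix_power (adj U) m) * cnj (power_sum_trace (G - {#m#}) U))"
      by (rule sum_mset_negf)
    finally show ?thesis
      by (simp add: trace_mult sum_mset_distrib_left sum_sum_mset_swap sum_distrib_left sum_distrib_right mult_ac)
  qed
  have "?dk $ i $ j * ?f * ?g + ?P k $ i $ j * ?dF * ?g + ?P k $ i $ j * ?f * cnj ?dG =
    (\<Sum>p\<in>UNIV. \<Sum>q\<in>UNIV. A $ p $ q * loop_density k i j F G p q U)"
    unfolding dk dF dG loop_density_def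
    by (simp add: sum_distrib_left sum_distrib_right sum.distrib sum_subtractf ring_distribs mult_ac)
  with deriv show ?thesis by simp
qed

lemma has_vector_derivative_difference_quotient:
  assumes "(f has_vector_derivative f') (at 0)"
  shows "(\<lambda>n. real (Suc n) *\<^sub>R (f (1 / real (Suc n)) - f 0)) \<longlonglongrightarrow> f'"
proof -
  have "((\<lambda>y. (f y - f 0 - y *\<^sub>R f') /\<^sub>R norm y) \<longlongrightarrow> 0) (at 0)"
    using assms by (simp add: has_vector_derivative_def has_derivative_at_within)
  moreover have "filterlim (\<lambda>n. 1 / real (Suc n)) (at 0) sequentially"
    by (simp add: filterlim_at LIMSEQ_Suc[OF lim_1_over_n] del: of_nat_Suc)
  ultimately have "(\<lambda>n. (f (1 / real (Suc n)) - f 0 - (1 / real (Suc n)) *\<^sub>R f') /\<^sub>R norm (1 / real (Suc n)))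
      \<longlonglongrightarrow> 0"
    by (rule filterlim_compose)
  also have "(\<lambda>n. (f (1 / real (Suc n)) - f 0 - (1 / real (Suc n)) *\<^sub>R f') /\<^sub>R norm (1 / real (Suc n)))
      = (\<lambda>n. real (Suc n) *\<^sub>R (f (1 / real (Suc n)) - f 0) - f')"
    by (simp add: fun_eq_iff scaleR_diff_right del: of_nat_Suc)
  finally show ?thesis by (rule LIM_zero_cancel)
qed

locale unitary_ensemble = prob_space M for M :: "(complex ^ 'n ^ 'n) measure" +
  assumes sets_M: "sets M = sets borel"
    and AE_unitary: "AE U in M. U \<in> unitary_group"
begin

lemma borel_measurable_continuous:
  fixes f :: "complex ^ 'n ^ 'n \<Rightarrow> 'b::topological_space"
  shows "continuous_on UNIV f \<Longrightarrow> f \<in> borel_measurable M"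
  using borel_measurable_continuous_onI measurable_cong_sets[OF sets_M refl] by blast

lemma integrable_continuous:
  fixes f :: "complex ^ 'n ^ 'n \<Rightarrow> complex"
  assumes "continuous_on UNIV f"
  shows "integrable M f"
proof -
  have "bounded (f ` unitary_group)"
    by (intro compact_imp_bounded compact_continuous_image compact_unitary_group
        continuous_on_subset[OF assms]) auto
  then obtain B where "\<And>U. U \<in> unitary_group \<Longrightarrow> norm (f U) \<le> B"
    by (auto simp: bounded_iff)
  thus ?thesis
    using AE_unitary by (intro integrable_const_bound[of _ B] borel_measurable_continuous assms) auto
qed

definition invariant_under :: "complex ^ 'n ^ 'n \<Rightarrow> bool" where
  "invariant_under g \<longleftrightarrow> distr M borel ((**) g) = distr M borel (\<lambda>U. U)"

lemma integral_invariant: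
  fixes f :: "complex ^ 'n ^ 'n \<Rightarrow> complex"
  assumes "invariant_under g" "continuous_on UNIV f"
  shows "(\<integral>U. f (g ** U) \<partial>M) = (\<integral>U. f U \<partial>M)"
proof -
  have "(\<integral>U. f U \<partial>distr M borel ((**) g)) = (\<integral>U. f (g ** U) \<partial>M)"
    by (intro integral_distr borel_measurable_continuous borel_measurable_continuous_onI assms
        matrix_continuous_intros)
  moreover have "(\<integral>U. f U \<partial>distr M borel (\<lambda>U. U)) = (\<integral>U. f U \<partial>M)"
    by (intro integral_distr borel_measurable_continuous borel_measurable_continuous_onI assms
        continuous_intros)
  ultimately show ?thesis using assms(1) by (simp add: invariant_under_def)
qed

lemma integral_derivative_eq_0:
  fixes f f' :: "complex ^ 'n ^ 'n \<Rightarrow> complex"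
  assumes cont: "continuous_on UNIV f" "continuous_on UNIV f'"
    and A: "A ** A ** A = - A" "adj A = - A" and inv: "\<And>t. invariant_under (rotation A t)"
    and deriv: "\<And>U. ((\<lambda>t. f (rotation A t ** U)) has_vector_derivative f' U) (at 0)"
  shows "(\<integral>U. f' U \<partial>M) = 0"
proof -
  have "bounded (f' ` unitary_group)"
    by (intro compact_imp_bounded compact_continuous_image compact_unitary_group
        continuous_on_subset[OF cont(2)]) auto
  then obtain B where B: "\<And>U. U \<in> unitary_group \<Longrightarrow> norm (f' U) \<le> B"
    by (auto simp: bounded_iff)
  have deriv': "((\<lambda>s. f (rotation A s ** U)) has_vector_derivative f' (rotation A t ** U)) (at t)" for t U
  proof -
    have "((\<lambda>s. s - t) has_vector_derivative 1) (at t)"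
      by (auto intro!: derivative_eq_intros)
    moreover have "((\<lambda>s. f (rotation A s ** (rotation A t ** U))) has_vector_derivative f' (rotation A t ** U)) (at (t - t))"
      using deriv by simp
    ultimately have "((\<lambda>s. f (rotation A s ** (rotation A t ** U))) \<circ> (\<lambda>s. s - t) has_vector_derivative
        1 *\<^sub>R f' (rotation A t ** U)) (at t)"
      by (rule vector_diff_chain_at)
    moreover have "((\<lambda>s. f (rotation A s ** (rotation A t ** U))) \<circ> (\<lambda>s. s - t)) = (\<lambda>s. f (rotation A s ** U))"
      by (auto simp: fun_eq_iff matrix_mul_assoc simp flip: rotation_add[OF A(1)])
    ultimately show ?thesis by simp
  qed
  define s where "s n U = real (Suc n) *\<^sub>R (f (rotation A (1 / real (Suc n)) ** U) - f (rotation A 0 ** U))" for n U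
  have s_bound: "norm (s n U) \<le> B" if U: "U \<in> unitary_group" for n U
  proof -
    have "norm (f (rotation A (1 / real (Suc n)) ** U) - f (rotation A 0 ** U)) \<le> B * (1 / real (Suc n)) - B * 0"
    proof (rule differentiable_bound_general[where \<phi> = "\<lambda>x. B * x" and \<phi>' = "\<lambda>_. B"])
      show "continuous_on {0..1 / real (Suc n)} (\<lambda>t. f (rotation A t ** U))"
        by (intro continuous_at_imp_continuous_on ballI has_vector_derivative_continuous[OF deriv'])
      show "norm (f' (rotation A t ** U)) \<le> B" for t
        by (intro B unitary_group_mult rotation_unitary A U)
    qed (use deriv' in \<open>auto intro!: derivative_eq_intros continuous_intros\<close>)
    hence "norm (s n U) \<le> real (Suc n) * (B * (1 / real (Suc n)))"
      unfolding s_def norm_scaleR by (intro mult_mono) auto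
    thus ?thesis by simp
  qed
  have "(\<lambda>n. \<integral>U. s n U \<partial>M) \<longlonglongrightarrow> (\<integral>U. f' U \<partial>M)"
  proof (rule integral_dominated_convergence[where w = "\<lambda>_. B"])
    show "AE U in M. (\<lambda>n. s n U) \<longlonglongrightarrow> f' U"
      unfolding s_def by (intro AE_I2 has_vector_derivative_difference_quotient deriv)
    show "AE U in M. norm (s n U) \<le> B" for n
      using AE_unitary s_bound by auto
    show "s n \<in> borel_measurable M" for n
      unfolding s_def
      by (intro borel_measurable_continuous continuous_on_scaleR continuous_on_diff continuous_on_const
          continuous_on_compose2[OF cont(1)] continuous_on_matrix_mult continuous_on_id) auto
  qed (auto intro: borel_measurable_continuous cont)
  moreover have "(\<integral>U. s n U \<partial>M) = 0" for n
  proof -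
    have "continuous_on UNIV (\<lambda>U :: complex ^ 'n ^ 'n. g ** U)" for g :: "complex ^ 'n ^ 'n"
      using continuous_on_matrix_mult[OF continuous_on_const continuous_on_id, of UNIV g] by simp
    hence c: "continuous_on UNIV (\<lambda>U. f (g ** U))" for g :: "complex ^ 'n ^ 'n"
      by (intro continuous_on_compose2[OF cont(1)]) auto
    show ?thesis
      unfolding s_def using integral_invariant[OF inv cont(1)]
      by (simp add: integrable_continuous[OF c] integrable_continuous[OF cont(1)])
  qed
  ultimately show ?thesis by (simp add: LIMSEQ_const_iff)
qed

lemma integral_sum_mset:
  fixes f :: "'i \<Rightarrow> complex ^ 'n ^ 'n \<Rightarrow> complex"
  assumes "\<And>i. integrable M (f i)"
  shows "(\<integral>U. (\<Sum>i\<in>#F. f i U) \<partial>M) = (\<Sum>i\<in>#F. \<integral>U. f i U \<partial>M)"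
proof (induction F)
  case (add x F)
  have "integrable M (\<lambda>U. \<Sum>i\<in>#F. f i U)"
    by (induction F) (auto intro: assms)
  thus ?case using add assms by simp
qed simp

lemma loop_density_pairing:
  assumes "A ** A ** A = - A" "adj A = - A" "\<And>t. invariant_under (rotation A t)"
  shows "(\<Sum>p\<in>UNIV. \<Sum>q\<in>UNIV. A $ p $ q * (\<integral>U. loop_density k i j F G p q U \<partial>M)) = 0"
proof -
  have "(\<integral>U. (\<Sum>p\<in>UNIV. \<Sum>q\<in>UNIV. A $ p $ q * loop_density k i j F G p q U) \<partial>M) = 0"
  proof (rule integral_derivative_eq_0[OF _ _ assms])
    fix U
    have "has_entry_derivative (\<lambda>t. rotation A t ** U) (A ** U)"
      using has_entry_derivative_mult[OF has_entry_derivative_rotation[of A] has_entry_derivative_const[of U]]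
      by (simp add: vec_eq_iff matrix_mult_nth has_entry_derivative_def)
    thus "((\<lambda>t. (\<lambda>U. matrix_power U k $ i $ j * power_sum_trace F U * cnj (power_sum_trace G U)) (rotation A t ** U))
      has_vector_derivative (\<Sum>p\<in>UNIV. \<Sum>q\<in>UNIV. A $ p $ q * loop_density k i j F G p q U)) (at 0)"
      by (intro has_vector_derivative_loop_test_function assms) auto
  qed (intro matrix_continuous_intros continuous_on_loop_density)+
  moreover have "(\<integral>U. (\<Sum>p\<in>UNIV. \<Sum>q\<in>UNIV. A $ p $ q * loop_density k i j F G p q U) \<partial>M) =
      (\<Sum>p\<in>UNIV. \<Sum>q\<in>UNIV. A $ p $ q * (\<integral>U. loop_density k i j F G p q U \<partial>M))"
  proof -
    have "integrable M (\<lambda>U. A $ p $ q * loop_density k i j F G p q U)" for p q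
      by (intro integrable_continuous matrix_continuous_intros continuous_on_loop_density)
    thus ?thesis by (simp add: Bochner_Integration.integral_sum)
  qed
  ultimately show ?thesis by simp
qed

end

section \<open>Loop equations\<close>

definition elementary_skew :: "'n \<Rightarrow> 'n \<Rightarrow> complex \<Rightarrow> complex ^ 'n ^ 'n" where
  "elementary_skew p q z =
    (\<chi> i j. (if i = p \<and> j = q then z else 0) - (if i = q \<and> j = p then cnj z else 0))"

lemma elementary_skew_adj: "adj (elementary_skew p q z) = - elementary_skew p q z"
proof -
  have "cnj (elementary_skew p q z $ j $ i) = - elementary_skew p q z $ i $ j" for i j
    unfolding elementary_skew_def vec_lambda_beta complex_cnj_diff if_distrib[of cnj] complex_cnj_cnj
      complex_cnj_zero minus_diff_eq
    by (simp only: conj_commute)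
  thus ?thesis by (simp add: vec_eq_iff adj_nth)
qed

lemma elementary_skew_mult_nth:
  "(elementary_skew p q z ** B) $ i $ j =
    (if i = p then z * B $ q $ j else 0) - (if i = q then cnj z * B $ p $ j else 0)"
proof -
  have "(elementary_skew p q z ** B) $ i $ j =
      (\<Sum>k\<in>UNIV. (if k = q then (if i = p then z * B $ q $ j else 0) else 0)
        - (if k = p then (if i = q then cnj z * B $ p $ j else 0) else 0))"
    unfolding matrix_mult_nth by (intro sum.cong) (auto simp: elementary_skew_def algebra_simps)
  thus ?thesis by (simp add: sum_subtractf)
qed

lemma elementary_skew_cube:
  assumes "p \<noteq> q \<and> norm z = 1 \<or> p = q \<and> z = \<i> / 2"
  shows "elementary_skew p q z ** elementary_skew p q z ** elementary_skew p q z = - elementary_skew p q z"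
proof -
  let ?A = "elementary_skew p q z"
  have "(?A ** (?A ** ?A)) $ i $ j = - ?A $ i $ j" for i j
  proof (cases "i = p \<or> i = q")
    case False
    thus ?thesis unfolding elementary_skew_mult_nth by (simp add: elementary_skew_def)
  next
    case True
    show ?thesis
    proof (cases "p = q")
      case pq: True
      with assms have z: "z = \<i> / 2" by simp
      show ?thesis
        using True unfolding elementary_skew_mult_nth z pq by (simp add: ring_distribs)
    next
      case False
      with assms have "z * cnj z = 1" by (simp flip: complex_norm_square)
      hence "z * (cnj z * w) = w" "cnj z * (z * w) = w" for w
        by (simp_all flip: mult.assoc) (simp_all add: mult.commute)
      thus ?thesis
        using True False unfolding elementary_skew_mult_nth by auto
    qed
  qed
  thus ?thesis by (simp add: vec_eq_iff flip: matrix_mul_assoc)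
qed

lemma sum_elementary_skew:
  "(\<Sum>i\<in>UNIV. \<Sum>j\<in>UNIV. elementary_skew p q z $ i $ j * f i j) = z * f p q - cnj z * f q p"
proof -
  have "elementary_skew p q z $ i $ j * f i j =
      (if j = q then (if i = p then z * f p q else 0) else 0)
      - (if j = p then (if i = q then cnj z * f q p else 0) else 0)" for i j
    by (simp add: elementary_skew_def left_diff_distrib)
  thus ?thesis by (simp add: sum_subtractf)
qed

lemma sum_lessThan_split_0:
  fixes f :: "nat \<Rightarrow> complex"
  assumes "0 < k"
  shows "(\<Sum>a<k. f a) = f 0 + (\<Sum>a\<in>{1..<k}. f a)"
  using assms by (simp add: lessThan_atLeast0 sum.atLeast_Suc_lessThan)

lemma sum_loop_density:
  fixes U :: "complex ^ 'n ^ 'n"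
  assumes k: "0 < k"
  shows "(\<Sum>i\<in>UNIV. \<Sum>j\<in>UNIV. loop_density k i j F G i j U) =
    of_nat CARD('n) * (power_sum_trace (add_mset k F) U * cnj (power_sum_trace G U))
    + (\<Sum>a\<in>{1..<k}. power_sum_trace (add_mset a (add_mset (k - a) F)) U * cnj (power_sum_trace G U))
    + (\<Sum>m\<in>#F. of_nat m * (power_sum_trace (add_mset (k + m) (F - {#m#})) U * cnj (power_sum_trace G U)))
    - (\<Sum>m\<in>#G. of_nat m * (trace (matrix_power U k ** matrix_power (adj U) m)
        * power_sum_trace F U * cnj (power_sum_trace (G - {#m#}) U)))"
proof -
  let ?P = "\<lambda>k. matrix_power U k"
  let ?f = "power_sum_trace F U" and ?g = "cnj (power_sum_trace G U)"
  have 1: "(\<Sum>i\<in>UNIV. \<Sum>j\<in>UNIV. (\<Sum>a<k. ?P a $ i $ i * ?P (k - a) $ j $ j)) =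
      (\<Sum>a<k. trace (?P a) * trace (?P (k - a)))"
    by (simp only: sum.swap[of _ _ "{..<k}"] trace_def sum_product)
  have 2: "(\<Sum>i\<in>UNIV. \<Sum>j\<in>UNIV. ?P k $ i $ j * (\<Sum>m\<in>#F. of_nat m * ?P m $ j $ i * power_sum_trace (F - {#m#}) U))
      = (\<Sum>m\<in>#F. of_nat m * (trace (?P (k + m)) * power_sum_trace (F - {#m#}) U))"
    by (simp add: matrix_power_add trace_mult sum_mset_distrib_left sum_sum_mset_swap sum_distrib_left
        sum_distrib_right mult_ac)
  have 3: "(\<Sum>i\<in>UNIV. \<Sum>j\<in>UNIV. ?P k $ i $ j * (\<Sum>m\<in>#G. of_nat m * matrix_power (adj U) m $ j $ i * cnj (power_sum_trace (G - {#m#}) U)))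
      = (\<Sum>m\<in>#G. of_nat m * (trace (?P k ** matrix_power (adj U) m) * cnj (power_sum_trace (G - {#m#}) U)))"
    by (simp add: trace_mult sum_mset_distrib_left sum_sum_mset_swap sum_distrib_left
        sum_distrib_right mult_ac)
  have gen: "(\<Sum>i\<in>UNIV. \<Sum>j\<in>UNIV. x i j * f * g + w i j * y i j * g - w i j * f * z i j) =
      (\<Sum>i\<in>UNIV. \<Sum>j\<in>UNIV. x i j) * (f * g) + (\<Sum>i\<in>UNIV. \<Sum>j\<in>UNIV. w i j * y i j) * g
      - (\<Sum>i\<in>UNIV. \<Sum>j\<in>UNIV. w i j * z i j) * f" for x y z w :: "'n \<Rightarrow> 'n \<Rightarrow> complex" and f g
    by (simp add: sum.distrib sum_subtractf sum_distrib_left sum_distrib_right mult_ac)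
  have "(\<Sum>i\<in>UNIV. \<Sum>j\<in>UNIV. loop_density k i j F G i j U) =
    (\<Sum>i\<in>UNIV. \<Sum>j\<in>UNIV. (\<Sum>a<k. ?P a $ i $ i * ?P (k - a) $ j $ j)) * (?f * ?g)
    + (\<Sum>i\<in>UNIV. \<Sum>j\<in>UNIV. ?P k $ i $ j * (\<Sum>m\<in>#F. of_nat m * ?P m $ j $ i * power_sum_trace (F - {#m#}) U)) * ?g
    - (\<Sum>i\<in>UNIV. \<Sum>j\<in>UNIV. ?P k $ i $ j * (\<Sum>m\<in>#G. of_nat m * matrix_power (adj U) m $ j $ i * cnj (power_sum_trace (G - {#m#}) U))) * ?f"
    unfolding loop_density_def by (rule gen)
  thus ?thesis
    unfolding 1 2 3 unfolding sum_lessThan_split_0[OF k]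
    by (simp add: trace_I sum_mset_distrib_left sum_mset_distrib_right sum_distrib_left sum_distrib_right
        ring_distribs mult_ac)
qed

lemma sum_loop_density_transposed:
  fixes U :: "complex ^ 'n ^ 'n"
  shows "(\<Sum>i\<in>UNIV. \<Sum>j\<in>UNIV. loop_density k i j F {#} j i U) =
    (\<Sum>a<k. trace (matrix_power U a ** Finite_Cartesian_Product.transpose (matrix_power U (k - a))) * power_sum_trace F U)
    + (\<Sum>m\<in>#F. of_nat m * (trace (matrix_power U k ** Finite_Cartesian_Product.transpose (matrix_power U m))
        * power_sum_trace (F - {#m#}) U))"
proof -
  let ?P = "\<lambda>k. matrix_power U k"
  let ?f = "power_sum_trace F U"
  have 1: "(\<Sum>i\<in>UNIV. \<Sum>j\<in>UNIV. (\<Sum>a<k. ?P a $ i $ j * ?P (k - a) $ i $ j)) =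
      (\<Sum>a<k. trace (matrix_power U a ** Finite_Cartesian_Product.transpose (matrix_power U (k - a))))"
    by (simp only: sum.swap[of _ _ "{..<k}"] trace_mult_transpose)
  have 2: "(\<Sum>i\<in>UNIV. \<Sum>j\<in>UNIV. ?P k $ i $ j * (\<Sum>m\<in>#F. of_nat m * ?P m $ i $ j * power_sum_trace (F - {#m#}) U))
      = (\<Sum>m\<in>#F. of_nat m * (trace (matrix_power U k ** Finite_Cartesian_Product.transpose (matrix_power U m)) * power_sum_trace (F - {#m#}) U))"
    by (simp add: trace_mult_transpose sum_mset_distrib_left sum_sum_mset_swap sum_distrib_left
        sum_distrib_right mult_ac)
  have "(\<Sum>i\<in>UNIV. \<Sum>j\<in>UNIV. loop_density k i j F {#} j i U) =
    (\<Sum>i\<in>UNIV. \<Sum>j\<in>UNIV. (\<Sum>a<k. ?P a $ i $ j * ?P (k - a) $ i $ j)) * ?f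
    + (\<Sum>i\<in>UNIV. \<Sum>j\<in>UNIV. ?P k $ i $ j * (\<Sum>m\<in>#F. of_nat m * ?P m $ i $ j * power_sum_trace (F - {#m#}) U))"
    unfolding loop_density_def by (simp add: sum_distrib_right sum.distrib)
  thus ?thesis
    unfolding 1 2 by (simp add: sum_distrib_right)
qed

context unitary_ensemble
begin

definition pair_integral :: "nat multiset \<Rightarrow> nat multiset \<Rightarrow> complex" where
  "pair_integral F G = (\<integral>U. power_sum_trace F U * cnj (power_sum_trace G U) \<partial>M)"

lemma pair_integral_empty [simp]: "pair_integral {#} {#} = 1"
  by (simp add: pair_integral_def prob_space)

lemma pair_integral_add_0:
  "pair_integral (add_mset 0 F) G = of_nat CARD('n) * pair_integral F G"
  by (simp add: pair_integral_def trace_I mult.assoc)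

lemma loop_density_skew:
  assumes "\<And>t. invariant_under (rotation (elementary_skew p q z) t)"
    and "p \<noteq> q \<and> norm z = 1 \<or> p = q \<and> z = \<i> / 2"
  shows "z * (\<integral>U. loop_density k i j F G p q U \<partial>M) = cnj z * (\<integral>U. loop_density k i j F G q p U \<partial>M)"
  using loop_density_pairing[OF elementary_skew_cube[OF assms(2)] elementary_skew_adj assms(1)]
  unfolding sum_elementary_skew by (simp only: right_minus_eq)

lemma integral_sum_loop_density:
  "(\<integral>U. (\<Sum>i\<in>UNIV. \<Sum>j\<in>UNIV. loop_density k i j F G (p i j) (q i j) U) \<partial>M) =
    (\<Sum>i\<in>UNIV. \<Sum>j\<in>UNIV. \<integral>U. loop_density k i j F G (p i j) (q i j) U \<partial>M)"
proof -
  have "integrable M (loop_density k i j F G p q)" for i j p q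
    by (intro integrable_continuous continuous_on_loop_density)
  thus ?thesis by (simp add: Bochner_Integration.integral_sum)
qed

lemma integral_sum_loop_density_eq:
  assumes k: "0 < k"
  shows "(\<Sum>i\<in>UNIV. \<Sum>j\<in>UNIV. \<integral>U. loop_density k i j F G i j U \<partial>M) =
    of_nat CARD('n) * pair_integral (add_mset k F) G
    + (\<Sum>a\<in>{1..<k}. pair_integral (add_mset a (add_mset (k - a) F)) G)
    + (\<Sum>m\<in>#F. of_nat m * pair_integral (add_mset (k + m) (F - {#m#})) G)
    - (\<Sum>m\<in>#G. of_nat m * (\<integral>U. trace (matrix_power U k ** matrix_power (adj U) m)
        * power_sum_trace F U * cnj (power_sum_trace (G - {#m#}) U) \<partial>M))"
proof -
  have i1: "integrable M (\<lambda>U. power_sum_trace F U * cnj (power_sum_trace G U))" for F G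
    by (intro integrable_continuous matrix_continuous_intros)
  have i2: "integrable M (\<lambda>U. trace (matrix_power U k ** matrix_power (adj U) m)
      * power_sum_trace F U * cnj (power_sum_trace G U))" for m G
    by (intro integrable_continuous matrix_continuous_intros)
  have i3: "integrable M (\<lambda>U. \<Sum>m\<in>#F. f m U)" if "\<And>m. integrable M (f m)" for F and f :: "nat \<Rightarrow> complex ^ 'n ^ 'n \<Rightarrow> complex"
    using that by (induction F) auto
  show ?thesis
    unfolding integral_sum_loop_density[symmetric] sum_loop_density[OF k] pair_integral_def
    by (simp only: Bochner_Integration.integral_diff Bochner_Integration.integral_add
      Bochner_Integration.integrable_diff Bochner_Integration.integrable_add
      Bochner_Integration.integrable_sum i1 i2 i3
      Bochner_Integration.integral_sum integral_sum_mset integral_mult_right_zero integrable_mult_right)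
qed

end

section \<open>Moments of the unitary and orthogonal groups\<close>

lemma diff_partition:
  "is_partition F \<Longrightarrow> is_partition (F - {#m#})"
  by (auto simp: is_partition_def dest: in_diffD)

lemma partition_of_0: "is_partition F \<Longrightarrow> \<Sum>\<^sub># F = 0 \<Longrightarrow> F = {#}"
  using set_mset_partition_subset[of F] by simp

lemma is_partition_add_mset [simp]: "is_partition (add_mset k F) \<longleftrightarrow> 0 < k \<and> is_partition F"
  by (auto simp: is_partition_def)

lemma sum_mset_cong:
  assumes "\<And>m. m \<in># F \<Longrightarrow> f m = g m"
  shows "(\<Sum>m\<in>#F. f m) = (\<Sum>m\<in>#F. g m)"
  using assms by (metis image_mset_cong)

locale haar_unitary = unitary_ensemble M for M :: "(complex ^ 'n ^ 'n) measure" +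
  assumes invariant: "g \<in> unitary_group \<Longrightarrow> invariant_under g"
begin

lemma integral_loop_density_eq_0: "(\<integral>U. loop_density k i j F G p q U \<partial>M) = 0"
proof -
  have *: "invariant_under (rotation (elementary_skew p q z) t)"
    if "p \<noteq> q \<and> norm z = 1 \<or> p = q \<and> z = \<i> / 2" for z t
    by (intro invariant rotation_unitary elementary_skew_cube elementary_skew_adj that)
  show ?thesis
  proof (cases "p = q")
    case True
    thus ?thesis
      using loop_density_skew[OF *, of "\<i> / 2" k i j F G] by simp
  next
    case False
    thus ?thesis
      using loop_density_skew[OF *, of 1 k i j F G] loop_density_skew[OF *, of \<i> k i j F G]
      by simp
  qed
qed

lemma pair_integral_loop_equation:
  assumes k: "0 < k"
  shows "of_nat CARD('n) * pair_integral (add_mset k F) G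
      + (\<Sum>a\<in>{1..<k}. pair_integral (add_mset a (add_mset (k - a) F)) G)
      + (\<Sum>m\<in>#F. of_nat m * pair_integral (add_mset (k + m) (F - {#m#})) G)
    = (\<Sum>m\<in>#G. of_nat m * (if m < k then pair_integral (add_mset (k - m) F) (G - {#m#})
        else if m = k then of_nat CARD('n) * pair_integral F (G - {#m#})
        else pair_integral F (add_mset (m - k) (G - {#m#}))))"
proof -
  have "(\<integral>U. trace (matrix_power U k ** matrix_power (adj U) m)
        * power_sum_trace F U * cnj (power_sum_trace (G - {#m#}) U) \<partial>M) =
      (if m < k then pair_integral (add_mset (k - m) F) (G - {#m#})
        else if m = k then of_nat CARD('n) * pair_integral F (G - {#m#})
        else pair_integral F (add_mset (m - k) (G - {#m#})))" for m
  proof -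
    have "(\<integral>U. trace (matrix_power U k ** matrix_power (adj U) m)
        * power_sum_trace F U * cnj (power_sum_trace (G - {#m#}) U) \<partial>M) =
      (\<integral>U. (if m \<le> k then trace (matrix_power U (k - m)) else cnj (trace (matrix_power U (m - k))))
        * power_sum_trace F U * cnj (power_sum_trace (G - {#m#}) U) \<partial>M)"
    proof (rule integral_cong_AE)
      show "(\<lambda>U. (if m \<le> k then trace (matrix_power U (k - m)) else cnj (trace (matrix_power U (m - k))))
        * power_sum_trace F U * cnj (power_sum_trace (G - {#m#}) U)) \<in> borel_measurable M"
        by (cases "m \<le> k") (auto intro!: borel_measurable_continuous matrix_continuous_intros)
      show "AE U in M. trace (matrix_power U k ** matrix_power (adj U) m)
        * power_sum_trace F U * cnj (power_sum_trace (G - {#m#}) U) =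
        (if m \<le> k then trace (matrix_power U (k - m)) else cnj (trace (matrix_power U (m - k))))
        * power_sum_trace F U * cnj (power_sum_trace (G - {#m#}) U)"
        using AE_unitary by eventually_elim (simp add: trace_power_mult_adj_power)
    qed (intro borel_measurable_continuous matrix_continuous_intros)
    also have "\<dots> = (if m < k then pair_integral (add_mset (k - m) F) (G - {#m#})
        else if m = k then of_nat CARD('n) * pair_integral F (G - {#m#})
        else pair_integral F (add_mset (m - k) (G - {#m#})))"
    proof (cases m k rule: linorder_cases)
      case greater
      thus ?thesis by (simp add: pair_integral_def mult_ac)
    qed (simp_all add: pair_integral_def trace_I mult.assoc)
    finally show ?thesis .
  qed
  thus ?thesis
    using integral_sum_loop_density_eq[OF k, of F G] by (simp add: integral_loop_density_eq_0)
qed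

theorem pair_integral_eq_power_sum_pairing:
  assumes "is_partition F" "is_partition G" "\<Sum>\<^sub># F = \<Sum>\<^sub># G" "\<Sum>\<^sub># G \<le> CARD('n)"
  shows "pair_integral F G = power_sum_pairing F G"
  using assms
proof (induction "\<Sum>\<^sub># G" arbitrary: F G rule: less_induct)
  case less
  show ?case
  proof (cases "\<Sum>\<^sub># G = 0")
    case True
    thus ?thesis using less.prems partition_of_0[of F] partition_of_0[of G] by simp
  next
    case False
    define v where "v F = pair_integral F G - power_sum_pairing F G" for F
    have n0: "0 < \<Sum>\<^sub># G" using False by (simp only: neq0_conv)
    have nc: "real (\<Sum>\<^sub># G) < real CARD('n) + 1" using less.prems(4) by linarith
    have "v F = 0"
    proof (rule cut_join_injective[where n = "\<Sum>\<^sub># G" and c = "CARD('n)"])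
      fix k H assume k: "0 < k" and H: "is_partition H" "k + \<Sum>\<^sub># H = \<Sum>\<^sub># G"
      have eq: "pair_integral F' G' = power_sum_pairing F' G'"
        if "is_partition F'" "is_partition G'" "\<Sum>\<^sub># F' = \<Sum>\<^sub># G'" "\<Sum>\<^sub># G' < \<Sum>\<^sub># G" for F' G'
        using less.hyps[of G' F'] that less.prems by simp
      have "(\<Sum>m\<in>#G. of_nat m * (if m < k then pair_integral (add_mset (k - m) H) (G - {#m#})
          else if m = k then of_nat CARD('n) * pair_integral H (G - {#m#})
          else pair_integral H (add_mset (m - k) (G - {#m#})))) =
        (\<Sum>m\<in>#G. of_nat m * (if m < k then power_sum_pairing (add_mset (k - m) H) (G - {#m#})
          else if m = k then of_nat CARD('n) * power_sum_pairing H (G - {#m#})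
          else power_sum_pairing H (add_mset (m - k) (G - {#m#}))))"
      proof (intro sum_mset_cong)
        fix m assume m: "m \<in># G"
        hence "0 < m" using less.prems(2) by (auto simp: is_partition_def intro: Nat.gr0I)
        moreover have "m + \<Sum>\<^sub># (G - {#m#}) = \<Sum>\<^sub># G"
          by (rule sum_mset_remove1_eq[OF m])
        ultimately show "of_nat m * (if m < k then pair_integral (add_mset (k - m) H) (G - {#m#})
          else if m = k then of_nat CARD('n) * pair_integral H (G - {#m#})
          else pair_integral H (add_mset (m - k) (G - {#m#}))) =
          of_nat m * (if m < k then power_sum_pairing (add_mset (k - m) H) (G - {#m#})
          else if m = k then of_nat CARD('n) * power_sum_pairing H (G - {#m#})
          else power_sum_pairing H (add_mset (m - k) (G - {#m#})))"
          using k H less.prems(2) diff_partition[OF less.prems(2), of m] by (auto simp: eq)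
      qed
      hence main: "of_nat CARD('n) * pair_integral (add_mset k H) G
          + (\<Sum>a\<in>{1..<k}. pair_integral (add_mset a (add_mset (k - a) H)) G)
          + (\<Sum>m\<in>#H. of_nat m * pair_integral (add_mset (k + m) (H - {#m#})) G)
        = of_nat CARD('n) * power_sum_pairing (add_mset k H) G
          + (\<Sum>a\<in>{1..<k}. power_sum_pairing (add_mset a (add_mset (k - a) H)) G)
          + (\<Sum>m\<in>#H. of_nat m * power_sum_pairing (add_mset (k + m) (H - {#m#})) G)"
        unfolding pair_integral_loop_equation[OF k] power_sum_pairing_loop_equation[OF k H(1) less.prems(2)] .
      have merge: "(\<Sum>m\<in>#H. of_nat m * v (add_mset (k + m) (H - {#m#}))) =
          (\<Sum>m\<in>#H. of_nat m * pair_integral (add_mset (k + m) (H - {#m#})) G)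
          - (\<Sum>m\<in>#H. of_nat m * power_sum_pairing (add_mset (k + m) (H - {#m#})) G)"
        unfolding v_def right_diff_distrib
        by (simp add: sum_mset_negf diff_conv_add_uminus sum_mset.distrib del: add_uminus_conv_diff)
      show "complex_of_real CARD('n) * v (add_mset k H)
        + (\<Sum>a\<in>{1..<k}. v (add_mset a (add_mset (k - a) H)))
        + (\<Sum>m\<in>#H. of_nat m * v (add_mset (k + m) (H - {#m#}))) = 0"
        unfolding merge unfolding v_def sum_subtractf using main by (simp add: algebra_simps)
    qed (rule n0 nc less.prems)+
    thus ?thesis by (simp add: v_def)
  qed
qed

lemma integral_homogeneous_eq_0:
  fixes f h :: "complex ^ 'n ^ 'n \<Rightarrow> complex"
  assumes cont: "continuous_on UNIV f" "continuous_on UNIV h"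
    and f: "\<And>z U. f (mat z ** U) = z ^ a * f U" and h: "\<And>z U. h (mat z ** U) = z ^ b * h U"
    and "a \<noteq> b"
  shows "(\<integral>U. f U * cnj (h U) \<partial>M) = 0"
proof -
  define \<theta> where "\<theta> = pi / (real a - real b)"
  have "mat (cis \<theta>) \<in> (unitary_group :: (complex ^ 'n ^ 'n) set)"
  proof -
    have "(adj (mat (cis \<theta>)) ** mat (cis \<theta>) :: complex ^ 'n ^ 'n) = mat 1"
      "(mat (cis \<theta>) ** adj (mat (cis \<theta>)) :: complex ^ 'n ^ 'n) = mat 1"
      by (auto simp: adj_mat vec_eq_iff mat_mult_nth, auto simp: mat_def cis_cnj cis_mult)
    thus ?thesis by (simp add: in_unitary_group)
  qed
  hence "(\<integral>U. f (mat (cis \<theta>) ** U) * cnj (h (mat (cis \<theta>) ** U)) \<partial>M) = (\<integral>U. f U * cnj (h U) \<partial>M)"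
    using cont by (intro integral_invariant invariant continuous_intros)
  moreover have "(\<lambda>U. f (mat (cis \<theta>) ** U) * cnj (h (mat (cis \<theta>) ** U))) = (\<lambda>U. - (f U * cnj (h U)))"
  proof
    fix U
    have "cis \<theta> ^ a * cnj (cis \<theta>) ^ b = cis ((real a - real b) * \<theta>)"
      by (simp only: cis_cnj Complex.DeMoivre cis_mult) (simp add: algebra_simps)
    also have "(real a - real b) * \<theta> = pi"
      using \<open>a \<noteq> b\<close> by (simp add: \<theta>_def)
    finally have "cis \<theta> ^ a * cnj (cis \<theta>) ^ b = - 1" by simp
    moreover have "f (mat (cis \<theta>) ** U) * cnj (h (mat (cis \<theta>) ** U)) =
        (cis \<theta> ^ a * cnj (cis \<theta>) ^ b) * (f U * cnj (h U))"
      unfolding f h by simp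
    ultimately show "f (mat (cis \<theta>) ** U) * cnj (h (mat (cis \<theta>) ** U)) = - (f U * cnj (h U))"
      by simp
  qed
  ultimately show ?thesis by simp
qed

end

definition real_matrix :: "complex ^ 'n ^ 'n \<Rightarrow> bool" where
  "real_matrix U \<longleftrightarrow> (\<forall>i j. Im (U $ i $ j) = 0)"

lemma real_matrix_power: "real_matrix U \<Longrightarrow> real_matrix (matrix_power U k)"
proof (induction k)
  case (Suc k)
  thus ?case by (simp add: real_matrix_def matrix_power_Suc matrix_mult_nth)
qed (simp add: real_matrix_def mat_def)

lemma real_matrix_transpose: "real_matrix U \<Longrightarrow> Finite_Cartesian_Product.transpose U = adj U"
  by (simp add: real_matrix_def vec_eq_iff adj_nth Finite_Cartesian_Product.transpose_def complex_eq_iff)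

lemma real_matrix_trace: "real_matrix U \<Longrightarrow> cnj (trace U) = trace U"
  by (simp add: real_matrix_def trace_def complex_eq_iff)

lemma trace_mult_transpose_real:
  assumes "real_matrix U" "U \<in> unitary_group"
  shows "trace (matrix_power U a ** Finite_Cartesian_Product.transpose (matrix_power U b)) =
    trace (matrix_power U (nat_dist a b))"
proof -
  have "Finite_Cartesian_Product.transpose (matrix_power U b) = matrix_power (adj U) b"
    using real_matrix_transpose[OF real_matrix_power[OF assms(1)]] by (simp add: adj_matrix_power)
  thus ?thesis
    using real_matrix_trace[OF real_matrix_power[OF assms(1)]]
    by (simp add: trace_power_mult_adj_power[OF assms(2)] nat_dist_def)
qed

lemma real_matrix_rotation_skew:
  fixes p q :: "'n::finite"
  shows "real_matrix (rotation (elementary_skew p q 1) t)"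
proof -
  have "Im (elementary_skew p q 1 $ i $ j) = 0" for i j
    by (simp only: elementary_skew_def vec_lambda_beta minus_complex.sel if_distrib[of Im] complex_cnj_one
        one_complex.sel zero_complex.sel if_cancel diff_self)
  moreover have "Im (mat 1 $ i $ j) = 0" for i j :: 'n
    by (simp add: mat_def)
  ultimately show ?thesis
    by (simp add: real_matrix_def rotation_def matrix_mult_nth)
qed

locale haar_orthogonal = unitary_ensemble M for M :: "(complex ^ 'n ^ 'n) measure" +
  assumes invariant: "g \<in> unitary_group \<Longrightarrow> real_matrix g \<Longrightarrow> invariant_under g"
    and AE_real: "AE U in M. real_matrix U"
begin

lemma moment_loop_equation:
  assumes k: "0 < k"
  shows "(of_nat CARD('n) - 1) * pair_integral (add_mset k F) {#}
      + (\<Sum>a\<in>{1..<k}. pair_integral (add_mset a (add_mset (k - a) F)) {#})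
      + (\<Sum>m\<in>#F. of_nat m * pair_integral (add_mset (k + m) (F - {#m#})) {#})
    = (\<Sum>a\<in>{1..<k}. pair_integral (add_mset (nat_dist a (k - a)) F) {#})
      + (\<Sum>m\<in>#F. of_nat m * pair_integral (add_mset (nat_dist k m) (F - {#m#})) {#})"
proof -
  have sym: "(\<integral>U. loop_density k i j F {#} p q U \<partial>M) = (\<integral>U. loop_density k i j F {#} q p U \<partial>M)" for i j p q
  proof (cases "p = q")
    case False
    have "invariant_under (rotation (elementary_skew p q 1) t)" for t
      using False by (intro invariant rotation_unitary elementary_skew_cube elementary_skew_adj real_matrix_rotation_skew) simp
    thus ?thesis using loop_density_skew[of p q 1 k i j F "{#}"] False by simp
  qed simp
  let ?g = "\<lambda>U. (\<Sum>a<k. power_sum_trace (add_mset (nat_dist a (k - a)) F) U)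
      + (\<Sum>m\<in>#F. of_nat m * power_sum_trace (add_mset (nat_dist k m) (F - {#m#})) U)"
  have i: "integrable M (power_sum_trace F)" for F
    by (intro integrable_continuous continuous_on_power_sum_trace continuous_on_id)
  have i': "integrable M (\<lambda>U. \<Sum>m\<in>#F. of_nat m * power_sum_trace (f m) U)" for F f
    by (intro integrable_continuous continuous_on_sum_mset continuous_intros continuous_on_power_sum_trace)
  have "(\<Sum>i\<in>UNIV. \<Sum>j\<in>UNIV. \<integral>U. loop_density k i j F {#} j i U \<partial>M) = (\<integral>U. ?g U \<partial>M)"
    unfolding integral_sum_loop_density[symmetric]
  proof (rule integral_cong_AE)
    show "AE U in M. (\<Sum>i\<in>UNIV. \<Sum>j\<in>UNIV. loop_density k i j F {#} j i U) = ?g U"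
      using AE_unitary AE_real
      by eventually_elim (simp add: sum_loop_density_transposed trace_mult_transpose_real)
  qed (intro borel_measurable_continuous matrix_continuous_intros continuous_on_loop_density)+
  also have "\<dots> = (\<Sum>a<k. pair_integral (add_mset (nat_dist a (k - a)) F) {#})
      + (\<Sum>m\<in>#F. of_nat m * pair_integral (add_mset (nat_dist k m) (F - {#m#})) {#})"
    by (simp add: pair_integral_def i i' integral_sum_mset del: power_sum_trace_add_mset)
  finally have "(\<Sum>i\<in>UNIV. \<Sum>j\<in>UNIV. \<integral>U. loop_density k i j F {#} i j U \<partial>M) = \<dots>"
    by (simp add: sym)
  thus ?thesis
    unfolding integral_sum_loop_density_eq[OF k] sum_lessThan_split_0[OF k]
    by (simp add: nat_dist_def algebra_simps)
qed

theorem moment_eq_gauss_moment: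
  assumes "is_partition F" "\<Sum>\<^sub># F < CARD('n)"
  shows "pair_integral F {#} = gauss_moment CARD('n) F"
  using assms
proof (induction "\<Sum>\<^sub># F" arbitrary: F rule: less_induct)
  case less
  show ?case
  proof (cases "\<Sum>\<^sub># F = 0")
    case True
    hence "F = {#}" by (rule partition_of_0[OF less.prems(1)])
    thus ?thesis by simp
  next
    case False
    define v where "v F = pair_integral F {#} - gauss_moment CARD('n) F" for F
    have n0: "0 < \<Sum>\<^sub># F" using False by (simp only: neq0_conv)
    have nc: "real (\<Sum>\<^sub># F) < real CARD('n) - 1 + 1" using less.prems(2) by linarith
    have "v F = 0"
    proof (rule cut_join_injective[where n = "\<Sum>\<^sub># F" and c = "real CARD('n) - 1"])
      fix k H assume k: "0 < k" and H: "is_partition H" "k + \<Sum>\<^sub># H = \<Sum>\<^sub># F"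
      have eq: "pair_integral F' {#} = gauss_moment CARD('n) F'"
        if "is_partition F'" "\<Sum>\<^sub># F' < \<Sum>\<^sub># F" for F'
        using less.hyps[of F'] that less.prems by simp
      have eq': "pair_integral (add_mset m F') {#} = gauss_moment CARD('n) (add_mset m F')"
        if "is_partition F'" "m + \<Sum>\<^sub># F' < \<Sum>\<^sub># F" for F' m
      proof (cases "m = 0")
        case True
        thus ?thesis using that
          by (simp add: pair_integral_add_0 gauss_moment_add_mset gauss_mean_def eq)
      qed (use that in \<open>simp add: eq\<close>)
      have "(\<Sum>a\<in>{1..<k}. pair_integral (add_mset (nat_dist a (k - a)) H) {#}) =
          (\<Sum>a\<in>{1..<k}. gauss_moment CARD('n) (add_mset (nat_dist a (k - a)) H))"
        by (intro sum.cong eq' H refl) (use H in \<open>auto simp: nat_dist_def\<close>)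
      moreover have "(\<Sum>m\<in>#H. of_nat m * pair_integral (add_mset (nat_dist k m) (H - {#m#})) {#}) =
          (\<Sum>m\<in>#H. of_nat m * gauss_moment CARD('n) (add_mset (nat_dist k m) (H - {#m#})))"
      proof (intro sum_mset_cong arg_cong2[of _ _ _ _ "(*)"] refl eq' diff_partition H)
        fix m assume m: "m \<in># H"
        hence "0 < m" using H by (auto simp: is_partition_def intro: Nat.gr0I)
        thus "nat_dist k m + \<Sum>\<^sub># (H - {#m#}) < \<Sum>\<^sub># F"
          using sum_mset_remove1_eq[OF m] H k by (auto simp: nat_dist_def)
      qed
      ultimately have main: "(of_nat CARD('n) - 1) * pair_integral (add_mset k H) {#}
          + (\<Sum>a\<in>{1..<k}. pair_integral (add_mset a (add_mset (k - a) H)) {#})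
          + (\<Sum>m\<in>#H. of_nat m * pair_integral (add_mset (k + m) (H - {#m#})) {#})
        = (of_nat CARD('n) - 1) * gauss_moment CARD('n) (add_mset k H)
          + (\<Sum>a\<in>{1..<k}. gauss_moment CARD('n) (add_mset a (add_mset (k - a) H)))
          + (\<Sum>m\<in>#H. of_nat m * gauss_moment CARD('n) (add_mset (k + m) (H - {#m#})))"
        unfolding moment_loop_equation[OF k] gauss_moment_loop_equation[OF k H(1)] by simp
      have merge: "(\<Sum>m\<in>#H. of_nat m * v (add_mset (k + m) (H - {#m#}))) =
          (\<Sum>m\<in>#H. of_nat m * pair_integral (add_mset (k + m) (H - {#m#})) {#})
          - (\<Sum>m\<in>#H. of_nat m * gauss_moment CARD('n) (add_mset (k + m) (H - {#m#})))"
        unfolding v_def right_diff_distrib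
        by (simp add: sum_mset_negf diff_conv_add_uminus sum_mset.distrib del: add_uminus_conv_diff)
      show "complex_of_real (real CARD('n) - 1) * v (add_mset k H)
        + (\<Sum>a\<in>{1..<k}. v (add_mset a (add_mset (k - a) H)))
        + (\<Sum>m\<in>#H. of_nat m * v (add_mset (k + m) (H - {#m#}))) = 0"
        unfolding merge unfolding v_def sum_subtractf using main by (simp add: algebra_simps)
    qed (rule n0 nc less.prems refl)+
    thus ?thesis by (simp add: v_def)
  qed
qed

end

section \<open>Power sums of eigenvalues\<close>

lemma poly_characteristic_poly: "poly (characteristic_poly A) z = det (mat z - A)"
proof -
  have "(\<Prod>i\<in>UNIV. poly ((if i = p i then [:0, 1:] else 0) - [:A $ i $ p i:]) z) =
      (\<Prod>i\<in>UNIV. (mat z - A) $ i $ p i)" for p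
    by (intro prod.cong) (auto simp: mat_def)
  thus ?thesis
    by (simp add: characteristic_poly_def det_def poly_sum poly_prod)
qed

lemma det_derivative_at_1:
  fixes B :: "complex ^ 'n ^ 'n"
  shows "((\<lambda>h. det (\<chi> i j. (if i = j then 1 else 0) + h * B $ i $ j)) has_field_derivative trace B) (at 0)"
proof -
  let ?f = "\<lambda>p i h. (if i = p i then 1 else 0) + h * B $ i $ p i"
  have *: "((\<lambda>h. \<Prod>i\<in>UNIV. ?f p i h) has_field_derivative
      (\<Sum>i\<in>UNIV. B $ i $ p i * (\<Prod>j\<in>UNIV - {i}. ?f p j 0))) (at 0)" for p :: "'n \<Rightarrow> 'n"
    by (rule has_field_derivative_prod) (auto intro!: derivative_eq_intros)
  have zero: "(\<Sum>i\<in>UNIV. B $ i $ p i * (\<Prod>j\<in>UNIV - {i}. ?f p j 0)) = 0"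
    if p: "p permutes UNIV" "p \<noteq> id" for p :: "'n \<Rightarrow> 'n"
  proof (intro sum.neutral ballI)
    fix i :: 'n
    have "\<exists>j. j \<noteq> i \<and> p j \<noteq> j"
    proof (rule ccontr)
      assume "\<not> ?thesis"
      hence fx: "\<And>j. j \<noteq> i \<Longrightarrow> p j = j" by blast
      hence "p i = i" using permutes_inj[OF p(1)] by (metis injD)
      with fx have "p = id" by (metis eq_id_iff)
      with p show False by simp
    qed
    then obtain j where "j \<noteq> i" "p j \<noteq> j" by blast
    hence "(\<Prod>j\<in>UNIV - {i}. ?f p j 0) = 0"
      by (intro prod_zero) (auto intro!: bexI[of _ j])
    thus "B $ i $ p i * (\<Prod>j\<in>UNIV - {i}. ?f p j 0) = 0" by simp
  qed
  have "((\<lambda>h. \<Sum>p\<in>{p. p permutes (UNIV :: 'n set)}. of_int (sign p) * (\<Prod>i\<in>UNIV. ?f p i h)) has_field_derivative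
      (\<Sum>p\<in>{p. p permutes UNIV}. of_int (sign p) * (\<Sum>i\<in>UNIV. B $ i $ p i * (\<Prod>j\<in>UNIV - {i}. ?f p j 0)))) (at 0)"
    by (intro DERIV_sum DERIV_cmult *)
  also have "(\<Sum>p\<in>{p. p permutes UNIV}. of_int (sign p) * (\<Sum>i\<in>UNIV. B $ i $ p i * (\<Prod>j\<in>UNIV - {i}. ?f p j 0)))
      = (\<Sum>p\<in>{id}. of_int (sign p) * (\<Sum>i\<in>UNIV. B $ i $ p i * (\<Prod>j\<in>UNIV - {i}. ?f p j 0)))"
  proof (rule sum.mono_neutral_right)
    show "\<forall>p\<in>{p. p permutes UNIV} - {id}.
        of_int (sign p) * (\<Sum>i\<in>UNIV. B $ i $ p i * (\<Prod>j\<in>UNIV - {i}. ?f p j 0)) = 0"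
    proof
      fix p assume "p \<in> {p. p permutes (UNIV :: 'n set)} - {id}"
      hence "(\<Sum>i\<in>UNIV. B $ i $ p i * (\<Prod>j\<in>UNIV - {i}. ?f p j 0)) = 0"
        by (intro zero) auto
      thus "of_int (sign p) * (\<Sum>i\<in>UNIV. B $ i $ p i * (\<Prod>j\<in>UNIV - {i}. ?f p j 0)) = 0"
        by (simp only: mult_zero_right)
    qed
  qed (auto simp: permutes_id finite_permutations)
  finally show ?thesis
    by (simp add: det_def trace_def)
qed

lemma det_resolvent_derivative:
  fixes A B :: "complex ^ 'n ^ 'n"
  assumes "(mat z - A) ** B = mat 1"
  shows "poly (pderiv (characteristic_poly A)) z = poly (characteristic_poly A) z * trace B"
proof -
  have eq: "det (mat (z + h) - A) = det (mat z - A) * det (\<chi> i j. (if i = j then 1 else 0) + h * B $ i $ j)" for h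
  proof -
    have "(mat z - A) ** (\<chi> i j. (if i = j then 1 else 0) + h * B $ i $ j) =
        (mat z - A) + (\<chi> i j. h * ((mat z - A) ** B) $ i $ j)"
    proof -
      have "(\<chi> i j. (if i = j then 1 else 0) + h * B $ i $ j) = mat 1 + (\<chi> i j. h * B $ i $ j)"
        by (simp add: vec_eq_iff mat_def)
      moreover have "(mat z - A) ** (\<chi> i j. h * B $ i $ j) = (\<chi> i j. h * ((mat z - A) ** B) $ i $ j)"
        by (simp add: vec_eq_iff matrix_mult_nth sum_distrib_left mult_ac)
      ultimately show ?thesis by (simp add: matrix_add_ldistrib)
    qed
    also have "\<dots> = mat (z + h) - A"
      unfolding assms by (simp add: vec_eq_iff mat_def)
    finally show ?thesis by (simp only: det_mul[symmetric])
  qed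
  have "((\<lambda>h. det (mat z - A) * det (\<chi> i j. (if i = j then 1 else 0) + h * B $ i $ j)) has_field_derivative
      det (mat z - A) * trace B) (at 0)"
    by (intro DERIV_cmult det_derivative_at_1)
  hence "((\<lambda>h. poly (characteristic_poly A) (z + h)) has_field_derivative det (mat z - A) * trace B) (at 0)"
    by (simp only: poly_characteristic_poly eq)
  hence "(poly (characteristic_poly A) has_field_derivative det (mat z - A) * trace B) (at (0 + z))"
    unfolding DERIV_shift by (simp add: add.commute)
  thus ?thesis
    using DERIV_unique[OF poly_DERIV] by (simp add: poly_characteristic_poly)
qed

lemma pderiv_prod_linear:
  fixes R :: "complex multiset"
  assumes "z \<notin># R"
  shows "poly (pderiv (\<Prod>x\<in>#R. [:- x, 1:])) z = poly (\<Prod>x\<in>#R. [:- x, 1:]) z * (\<Sum>x\<in>#R. 1 / (z - x))"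
  using assms
proof (induction R)
  case (add x R)
  hence "z \<noteq> x" by auto
  let ?P = "\<Prod>x\<in>#R. [:- x, 1:]"
  have "pderiv ([:- x, 1:] * ?P) = [:- x, 1:] * pderiv ?P + ?P"
    by (subst pderiv_mult) (simp add: pderiv_pCons)
  then have "poly (pderiv (\<Prod>x\<in>#add_mset x R. [:- x, 1:])) z = (z - x) * poly (pderiv ?P) z + poly ?P z"
    by (simp add: left_diff_distrib)
  also have "\<dots> = (z - x) * poly ?P z * (1 / (z - x) + (\<Sum>x\<in>#R. 1 / (z - x)))"
    using add \<open>z \<noteq> x\<close> by (simp add: field_simps)
  finally show ?case by (simp add: left_diff_distrib)
qed simp

lemma sums_sum_mset:
  fixes f :: "'i \<Rightarrow> nat \<Rightarrow> complex"
  assumes "\<And>i. i \<in># R \<Longrightarrow> f i sums g i"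
  shows "(\<lambda>n. \<Sum>i\<in>#R. f i n) sums (\<Sum>i\<in>#R. g i)"
  using assms by (induction R) (auto intro: sums_add)

locale power_bounded_matrix =
  fixes A :: "complex ^ 'n ^ 'n" and \<rho> :: real
  assumes power_bound: "norm (matrix_power A k $ i $ j) \<le> \<rho> ^ k" and rho_nonneg: "0 \<le> \<rho>"
begin

lemma resolvent_exists:
  assumes "\<rho> < norm z"
  obtains B where "(mat z - A) ** B = mat 1"
    "(\<lambda>k. trace (matrix_power A k) * (1 / z) ^ Suc k) sums trace B"
proof -
  define w where "w = 1 / z"
  have z: "z \<noteq> 0" using assms rho_nonneg by auto
  have zw: "z * w = 1" using z by (simp add: w_def)
  have small: "\<rho> * norm w < 1" using assms rho_nonneg z by (simp add: w_def norm_divide field_simps)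
  have summ: "summable (\<lambda>k. matrix_power A k $ i $ j * w ^ k)" for i j
  proof (rule summable_comparison_test')
    show "summable (\<lambda>k. (\<rho> * norm w) ^ k)"
      using small rho_nonneg by (intro summable_geometric) simp
    show "norm (matrix_power A k $ i $ j * w ^ k) \<le> (\<rho> * norm w) ^ k" for k
      unfolding norm_mult norm_power power_mult_distrib by (intro mult_right_mono power_bound) simp
  qed
  define B :: "complex ^ 'n ^ 'n" where "B = (\<chi> i j. (\<Sum>k. matrix_power A k $ i $ j * w ^ k) * w)"
  have sums: "(\<lambda>k. matrix_power A k $ i $ j * w ^ Suc k) sums (B $ i $ j)" for i j
    using sums_mult2[OF summable_sums[OF summ[of i j]], of w] by (simp add: B_def mult_ac)
  have "(A ** B) $ i $ j = z * B $ i $ j - (if i = j then 1 else 0)" for i j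
  proof -
    have "(\<lambda>k. \<Sum>l\<in>UNIV. A $ i $ l * (matrix_power A k $ l $ j * w ^ Suc k)) sums (\<Sum>l\<in>UNIV. A $ i $ l * B $ l $ j)"
      by (intro sums_sum sums_mult sums)
    hence "(\<lambda>k. matrix_power A (Suc k) $ i $ j * w ^ Suc k) sums (A ** B) $ i $ j"
      by (simp add: matrix_power_Suc matrix_mult_nth sum_distrib_right mult.assoc)
    hence "(\<lambda>k. matrix_power A k $ i $ j * w ^ k) sums ((A ** B) $ i $ j + mat 1 $ i $ j)"
      by (subst (asm) sums_Suc_iff) (simp add: mat_def)
    moreover have "(\<lambda>k. matrix_power A k $ i $ j * w ^ k) sums (z * B $ i $ j)"
    proof -
      have "z * (matrix_power A k $ i $ j * w ^ Suc k) = (z * w) * (matrix_power A k $ i $ j * w ^ k)" for k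
        by simp
      thus ?thesis using sums_mult[OF sums[of i j], of z] by (simp only: zw mult_1)
    qed
    ultimately have "(A ** B) $ i $ j + mat 1 $ i $ j = z * B $ i $ j"
      by (rule sums_unique2)
    thus ?thesis by (simp add: mat_def eq_diff_eq)
  qed
  moreover have "(mat z ** B) $ i $ j = z * B $ i $ j" for i j
    by (rule mat_mult_nth)
  ultimately have "(mat z - A) ** B = mat 1"
    by (simp add: vec_eq_iff matrix_mult_nth mat_def left_diff_distrib sum_subtractf)
  moreover have "(\<lambda>k. trace (matrix_power A k) * w ^ Suc k) sums trace B"
    unfolding trace_def sum_distrib_right by (intro sums_sum sums)
  ultimately show ?thesis using that w_def by blast
qed

lemma characteristic_poly_nonzero:
  assumes "\<rho> < norm z"
  shows "poly (characteristic_poly A) z \<noteq> 0"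
proof -
  obtain B where "(mat z - A) ** B = mat 1"
    using resolvent_exists[OF assms] by blast
  hence "det (mat z - A) * det B = 1" by (metis det_mul det_I)
  thus ?thesis by (auto simp: poly_characteristic_poly)
qed

lemma norm_root_le:
  assumes "x \<in># proots (characteristic_poly A)"
  shows "norm x \<le> \<rho>"
proof -
  have "characteristic_poly A \<noteq> 0" using assms by auto
  hence "poly (characteristic_poly A) x = 0" using assms by simp
  thus ?thesis using characteristic_poly_nonzero[of x] by fastforce
qed

lemma trace_resolvent_eq:
  assumes z: "\<rho> < norm z" and B: "(mat z - A) ** B = mat 1"
  shows "trace B = (\<Sum>x\<in>#proots (characteristic_poly A). 1 / (z - x))"
proof -
  let ?\<chi> = "characteristic_poly A"
  have nz: "poly ?\<chi> z \<noteq> 0" by (rule characteristic_poly_nonzero[OF z])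
  have "z \<notin># proots ?\<chi>" using norm_root_le[of z] z by auto
  moreover have dec: "smult (lead_coeff ?\<chi>) (\<Prod>x\<in>#proots ?\<chi>. [:- x, 1:]) = ?\<chi>"
    by (rule complex_poly_decompose_multiset)
  moreover have "poly (pderiv (smult c p)) z = poly (smult c p) z * s"
    if "poly (pderiv p) z = poly p z * s" for c s :: complex and p
    using that by (simp add: pderiv_smult)
  ultimately have "poly (pderiv ?\<chi>) z = poly ?\<chi> z * (\<Sum>x\<in>#proots ?\<chi>. 1 / (z - x))"
    using pderiv_prod_linear[of z "proots ?\<chi>"] by metis
  thus ?thesis using nz det_resolvent_derivative[OF B] by simp
qed

lemma trace_power_eq_sum_roots:
  "trace (matrix_power A k) = (\<Sum>x\<in>#proots (characteristic_poly A). x ^ k)"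
proof -
  define d where "d k = trace (matrix_power A k) - (\<Sum>x\<in>#proots (characteristic_poly A). x ^ k)" for k
  define h where "h = Abs_fps (\<lambda>n. if n = 0 then 0 else d (n - 1))"
  have h_sums: "(\<lambda>n. fps_nth h n * w ^ n) sums 0" if w: "norm w < 1 / (\<rho> + 1)" for w
  proof -
    have "(\<lambda>n. d n * w ^ Suc n) sums 0"
    proof (cases "w = 0")
      case False
      define z where "z = 1 / w"
      have wz: "w = 1 / z" "w \<noteq> 0" using False by (auto simp: z_def)
      have rw: "(\<rho> + 1) * norm w < 1" using w rho_nonneg by (simp add: field_simps)
      hence "\<rho> * norm w < 1" using norm_ge_zero[of w] unfolding distrib_right by linarith
      hence z: "\<rho> < norm z" using False by (simp add: z_def norm_divide field_simps)
      obtain B where B: "(mat z - A) ** B = mat 1"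
        and sB: "(\<lambda>k. trace (matrix_power A k) * (1 / z) ^ Suc k) sums trace B"
        using resolvent_exists[OF z] by blast
      have "(\<lambda>k. \<Sum>x\<in>#proots (characteristic_poly A). x ^ k * w ^ Suc k) sums
          (\<Sum>x\<in>#proots (characteristic_poly A). 1 / (z - x))"
      proof (rule sums_sum_mset)
        fix x assume "x \<in># proots (characteristic_poly A)"
        hence "norm x < norm z" using norm_root_le z by fastforce
        hence "norm (x * w) < 1" using False by (simp add: z_def norm_mult norm_divide field_simps)
        hence "(\<lambda>k. (x * w) ^ k * w) sums (1 / (1 - x * w) * w)"
          by (intro sums_mult2 geometric_sums)
        moreover have "1 / (1 - x * w) * w = 1 / (z - x)"
          using False by (simp add: z_def field_simps)
        ultimately show "(\<lambda>k. x ^ k * w ^ Suc k) sums (1 / (z - x))"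
          by (simp add: power_mult_distrib mult_ac)
      qed
      hence "(\<lambda>k. trace (matrix_power A k) * w ^ Suc k
          - (\<Sum>x\<in>#proots (characteristic_poly A). x ^ k * w ^ Suc k)) sums (trace B - trace B)"
        using sB unfolding trace_resolvent_eq[OF z B] wz(1) by (intro sums_diff)
      thus ?thesis
        by (simp add: d_def left_diff_distrib sum_mset_distrib_right)
    qed simp
    hence "(\<lambda>n. fps_nth h (Suc n) * w ^ Suc n) sums 0" by (simp add: h_def)
    thus ?thesis by (subst (asm) sums_Suc_iff) (simp add: h_def)
  qed
  define R where "R = 1 / (2 * (\<rho> + 1))"
  have R: "0 < R" "R < 1 / (\<rho> + 1)" using rho_nonneg by (auto simp: R_def field_simps)
  have "norm (complex_of_real R) \<le> fps_conv_radius h"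
    unfolding fps_conv_radius_def
    by (intro conv_radius_geI sums_summable[OF h_sums]) (use R in auto)
  hence "0 < fps_conv_radius h"
    using R by (metis abs_of_pos ereal_less(2) norm_of_real order_less_le_trans)
  moreover have "\<forall>\<^sub>F w in nhds 0. eval_fps h w = eval_fps 0 w"
    using eventually_nhds_in_open[of "ball 0 (1 / (\<rho> + 1))" "0 :: complex"] rho_nonneg
    by (auto elim!: eventually_mono simp: eval_fps_def sums_unique[OF h_sums, symmetric])
  ultimately have "h = 0"
    by (intro eval_fps_eqD) auto
  hence "fps_nth h (Suc k) = 0" by simp
  thus ?thesis by (simp add: h_def d_def)
qed

lemma mset_eigenvalue_list: "mset (eigenvalue_list A) = proots (characteristic_poly A)"
  unfolding eigenvalue_list_def by (rule someI_ex) (rule ex_mset)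

lemma length_eigenvalue_list: "length (eigenvalue_list A) = CARD('n)"
proof -
  have "of_nat (size (proots (characteristic_poly A))) = (of_nat CARD('n) :: complex)"
    using trace_power_eq_sum_roots[of 0] by (simp add: trace_I)
  thus ?thesis by (simp flip: mset_eigenvalue_list)
qed

lemma norm_eigenvalue_le: "i < CARD('n) \<Longrightarrow> norm (eigenvalue_list A ! i) \<le> \<rho>"
  using norm_root_le length_eigenvalue_list mset_eigenvalue_list by (metis nth_mem set_mset_mset)

lemma sum_eigenvalue_power: "(\<Sum>i<CARD('n). eigenvalue_list A ! i ^ k) = trace (matrix_power A k)"
proof -
  have "(\<Sum>i<CARD('n). eigenvalue_list A ! i ^ k) = (\<Sum>x\<leftarrow>eigenvalue_list A. x ^ k)"
    by (simp add: sum_list_sum_nth length_eigenvalue_list atLeast0LessThan)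
  also have "\<dots> = (\<Sum>x\<in>#proots (characteristic_poly A). x ^ k)"
    by (simp flip: mset_eigenvalue_list sum_mset_sum_list)
  finally show ?thesis by (simp add: trace_power_eq_sum_roots)
qed

end

section \<open>Expansion of the weight\<close>

function weight_coeff :: "(nat \<Rightarrow> complex) \<Rightarrow> nat \<Rightarrow> complex" where
  "weight_coeff q n = (if n = 0 then 1 else
    (\<Sum>m\<in>{1..n}. ((q m)\<^sup>2 + q (2 * m)) / 2 * weight_coeff q (n - m)) / of_nat n)"
  by pat_completeness auto
termination by (relation "Wellfounded.measure snd") auto

declare weight_coeff.simps [simp del]

lemma weight_coeff_0 [simp]: "weight_coeff q 0 = 1"
  by (simp add: weight_coeff.simps)

lemma weight_coeff_scale:
  "weight_coeff (\<lambda>m. c ^ m * q m) n = c ^ (2 * n) * weight_coeff q n"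
proof (induction n rule: less_induct)
  case (less n)
  show ?case
  proof (cases "n = 0")
    case False
    have "(\<Sum>m\<in>{1..n}. ((c ^ m * q m)\<^sup>2 + c ^ (2 * m) * q (2 * m)) / 2 * weight_coeff (\<lambda>m. c ^ m * q m) (n - m)) =
      (\<Sum>m\<in>{1..n}. c ^ (2 * n) * (((q m)\<^sup>2 + q (2 * m)) / 2 * weight_coeff q (n - m)))"
    proof (intro sum.cong refl)
      fix m assume m: "m \<in> {1..n}"
      have pow: "c ^ (2 * n) = c ^ (2 * m) * c ^ (2 * (n - m))"
        using m by (simp flip: power_add add: distrib_left[symmetric])
      have gen: "(x * Q + x * R) / 2 * (y * W) = (x * y) * ((Q + R) / 2 * W)" for x y Q R W :: complex
        by (simp add: field_simps)
      have c2: "(c ^ m * q m)\<^sup>2 = c ^ (2 * m) * (q m)\<^sup>2"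
        by (simp add: power_mult_distrib mult.commute flip: power_mult)
      have IH: "weight_coeff (\<lambda>m. c ^ m * q m) (n - m) = c ^ (2 * (n - m)) * weight_coeff q (n - m)"
        using m by (intro less) auto
      show "((c ^ m * q m)\<^sup>2 + c ^ (2 * m) * q (2 * m)) / 2 * weight_coeff (\<lambda>m. c ^ m * q m) (n - m) =
          c ^ (2 * n) * (((q m)\<^sup>2 + q (2 * m)) / 2 * weight_coeff q (n - m))"
        unfolding IH c2 pow by (rule gen)
    qed
    thus ?thesis
      using False by (simp add: weight_coeff.simps[of _ n] sum_distrib_left)
  qed simp
qed

lemma weight_coeff_unique:
  assumes "H 0 = 1"
    and "\<And>n. of_nat n * H n = (\<Sum>m\<in>{1..n}. ((q m)\<^sup>2 + q (2 * m)) / 2 * H (n - m))"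
  shows "H n = weight_coeff q n"
proof (induction n rule: less_induct)
  case (less n)
  show ?case
  proof (cases "n = 0")
    case False
    have "of_nat n * H n = (\<Sum>m\<in>{1..n}. ((q m)\<^sup>2 + q (2 * m)) / 2 * weight_coeff q (n - m))"
      unfolding assms(2) by (intro sum.cong) (auto simp: less)
    thus ?thesis using False by (simp add: weight_coeff.simps[of _ n] field_simps)
  qed (simp add: assms)
qed

definition geometric_fps :: "'a::comm_ring_1 \<Rightarrow> 'a fps" where
  "geometric_fps a = Abs_fps (\<lambda>n. a ^ n)"

lemma geometric_fps_euler:
  "fps_X * fps_deriv (geometric_fps a) = geometric_fps a * (geometric_fps a - 1)"
proof (rule fps_ext)
  fix n
  have "fps_nth (fps_X * fps_deriv (geometric_fps a)) n = of_nat n * a ^ n"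
    by (cases n) (auto simp: geometric_fps_def)
  moreover have "fps_nth (geometric_fps a * (geometric_fps a - 1)) n = of_nat n * a ^ n"
    unfolding right_diff_distrib fps_sub_nth fps_mult_nth[of "geometric_fps a" "geometric_fps a"]
    by (simp add: geometric_fps_def algebra_simps flip: power_add)
  ultimately show "fps_nth (fps_X * fps_deriv (geometric_fps a)) n = fps_nth (geometric_fps a * (geometric_fps a - 1)) n"
    by simp
qed

lemma prod_geometric_fps_euler:
  assumes "finite S"
  shows "fps_X * fps_deriv (\<Prod>s\<in>S. geometric_fps (a s)) =
    (\<Prod>s\<in>S. geometric_fps (a s)) * (\<Sum>s\<in>S. geometric_fps (a s) - 1)"
  using assms
proof (induction S rule: finite_induct)
  case (insert s S)
  let ?P = "\<Prod>s\<in>S. geometric_fps (a s)" and ?g = "geometric_fps (a s)"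
  have "fps_X * fps_deriv (?g * ?P) = ?g * (fps_X * fps_deriv ?P) + (fps_X * fps_deriv ?g) * ?P"
    by (simp add: algebra_simps)
  thus ?case using insert by (simp add: geometric_fps_euler algebra_simps)
qed simp

lemma prod_geometric_fps_recurrence:
  fixes a :: "'s \<Rightarrow> 'a::comm_ring_1"
  assumes "finite S"
  defines "H \<equiv> fps_nth (\<Prod>s\<in>S. geometric_fps (a s))"
  shows "of_nat n * H n = (\<Sum>m\<in>{1..n}. (\<Sum>s\<in>S. a s ^ m) * H (n - m))"
proof -
  let ?P = "\<Prod>s\<in>S. geometric_fps (a s)" and ?G = "\<Sum>s\<in>S. geometric_fps (a s) - 1"
  have "of_nat n * H n = fps_nth (fps_X * fps_deriv ?P) n"
    by (cases n) (auto simp: H_def)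
  also have "\<dots> = fps_nth (?G * ?P) n"
    by (simp add: prod_geometric_fps_euler[OF assms(1)] mult.commute)
  also have "\<dots> = (\<Sum>m\<in>{0..n}. fps_nth ?G m * H (n - m))"
    by (simp add: fps_mult_nth H_def)
  also have "\<dots> = (\<Sum>m\<in>{1..n}. fps_nth ?G m * H (n - m))"
    by (simp add: sum.atLeast_Suc_atMost geometric_fps_def fps_sum_nth)
  also have "\<dots> = (\<Sum>m\<in>{1..n}. (\<Sum>s\<in>S. a s ^ m) * H (n - m))"
    by (intro sum.cong) (auto simp: geometric_fps_def fps_sum_nth)
  finally show ?thesis .
qed

lemma prod_geometric_fps_eval:
  fixes a :: "'s \<Rightarrow> 'a::{real_normed_field, banach}"
  assumes "finite S" "\<And>s. s \<in> S \<Longrightarrow> norm (a s) \<le> \<rho>" "\<rho> < 1"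
  shows "1 < fps_conv_radius (\<Prod>s\<in>S. geometric_fps (a s)) \<and>
    eval_fps (\<Prod>s\<in>S. geometric_fps (a s)) 1 = (\<Prod>s\<in>S. 1 / (1 - a s))"
  using assms(1,2)
proof (induction S rule: finite_induct)
  case (insert s S)
  have as: "norm (a s) \<le> \<rho>" using insert.prems by simp
  hence rho: "0 \<le> \<rho>" using norm_ge_zero order_trans by blast
  define z where "z = 2 / (1 + \<rho>)"
  have z: "1 < z" "\<rho> * z < 1" using rho assms(3) by (auto simp: z_def field_simps)
  have "norm (a s * of_real z) \<le> \<rho> * z"
    using z as by (simp add: norm_mult mult_right_mono)
  hence "norm (a s * of_real z) < 1" using z by linarith
  hence "summable (\<lambda>n. (a s * of_real z) ^ n)"
    by (rule summable_geometric)
  hence "summable (\<lambda>n. fps_nth (geometric_fps (a s)) n * of_real z ^ n)"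
    by (simp add: geometric_fps_def power_mult_distrib)
  hence le: "ereal (norm (of_real z :: 'a)) \<le> fps_conv_radius (geometric_fps (a s))"
    unfolding fps_conv_radius_def by (rule conv_radius_geI)
  have "1 < ereal (norm (of_real z :: 'a))"
    using z by (simp add: one_ereal_def)
  from this le have r1: "1 < fps_conv_radius (geometric_fps (a s))"
    by (rule less_le_trans)
  have "norm (a s) < 1" using as assms(3) by simp
  hence e1: "eval_fps (geometric_fps (a s)) 1 = 1 / (1 - a s)"
    by (simp add: eval_fps_def geometric_fps_def suminf_geometric)
  have r2: "1 < fps_conv_radius (\<Prod>s\<in>S. geometric_fps (a s))"
    and e2: "eval_fps (\<Prod>s\<in>S. geometric_fps (a s)) 1 = (\<Prod>s\<in>S. 1 / (1 - a s))"
    using insert by auto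
  have "1 < min (fps_conv_radius (geometric_fps (a s))) (fps_conv_radius (\<Prod>s\<in>S. geometric_fps (a s)))"
    using r1 r2 by simp
  also have "\<dots> \<le> fps_conv_radius (geometric_fps (a s) * (\<Prod>s\<in>S. geometric_fps (a s)))"
    by (rule fps_conv_radius_mult)
  finally show ?case
    using insert.hyps r1 r2 e1 e2 by (simp add: eval_fps_mult one_ereal_def)
qed (auto simp: one_ereal_def)

lemma prod_geometric_fps_sums:
  fixes a :: "'s \<Rightarrow> 'a::{real_normed_field, banach}"
  assumes "finite S" "\<And>s. s \<in> S \<Longrightarrow> norm (a s) \<le> \<rho>" "\<rho> < 1"
  shows "fps_nth (\<Prod>s\<in>S. geometric_fps (a s)) sums (\<Prod>s\<in>S. 1 / (1 - a s))"
  using sums_eval_fps[of 1 "\<Prod>s\<in>S. geometric_fps (a s)"] prod_geometric_fps_eval[OF assms]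
  by (simp add: one_ereal_def)

lemma norm_prod_geometric_fps_le:
  fixes a :: "'s \<Rightarrow> 'a::real_normed_field"
  assumes "finite S" "\<And>s. s \<in> S \<Longrightarrow> norm (a s) \<le> \<rho>"
  shows "norm (fps_nth (\<Prod>s\<in>S. geometric_fps (a s)) n) \<le> fps_nth (\<Prod>s\<in>S. geometric_fps \<rho>) n"
  using assms
proof (induction S arbitrary: n rule: finite_induct)
  case (insert s S)
  have "norm (fps_nth (geometric_fps (a s) * (\<Prod>s\<in>S. geometric_fps (a s))) n) \<le>
      (\<Sum>i\<in>{0..n}. norm (a s) ^ i * norm (fps_nth (\<Prod>s\<in>S. geometric_fps (a s)) (n - i)))"
    unfolding fps_mult_nth by (rule order_trans[OF norm_sum]) (simp add: geometric_fps_def norm_mult norm_power)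
  also have "\<dots> \<le> (\<Sum>i\<in>{0..n}. \<rho> ^ i * fps_nth (\<Prod>s\<in>S. geometric_fps \<rho>) (n - i))"
    using insert.prems order_trans[OF norm_ge_zero insert.prems[of s]]
    by (intro sum_mono mult_mono power_mono insert.IH zero_le_power) auto
  finally show ?case
    using insert.hyps by (simp add: fps_mult_nth geometric_fps_def)
qed simp

lemma sum_le_pairs:
  fixes f :: "nat \<Rightarrow> complex"
  shows "2 * (\<Sum>(i, j)\<in>{(i, j). i \<le> j \<and> j < N}. f i * f j) = (\<Sum>i<N. f i)\<^sup>2 + (\<Sum>i<N. (f i)\<^sup>2)"
proof -
  have "(\<Sum>(i, j)\<in>{(i, j). i \<le> j \<and> j < N}. f i * f j) = (\<Sum>(j, i)\<in>Sigma {..<N} (\<lambda>j. {..j}). f i * f j)"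
    by (rule sum.reindex_bij_witness[of _ "\<lambda>(j, i). (i, j)" "\<lambda>(i, j). (j, i)"]) auto
  also have "\<dots> = (\<Sum>j<N. \<Sum>i\<le>j. f i * f j)"
    by (rule sum.Sigma[symmetric]) auto
  also have "2 * \<dots> = (\<Sum>i<N. f i)\<^sup>2 + (\<Sum>i<N. (f i)\<^sup>2)"
  proof (induction N)
    case (Suc N)
    have "(\<Sum>i\<le>N. f i * f N) = (\<Sum>i<N. f i) * f N + f N * f N"
      by (simp add: sum_distrib_right lessThan_Suc_atMost[symmetric])
    with Suc show ?case by (simp add: algebra_simps power2_eq_square)
  qed simp
  finally show ?thesis .
qed

lemma finite_le_pairs: "finite {(i, j). i \<le> j \<and> j < (N::nat)}"
  by (rule finite_subset[of _ "{..<N} \<times> {..<N}"]) auto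

context power_bounded_matrix
begin

definition eigenvalue_pair :: "nat \<times> nat \<Rightarrow> complex" where
  "eigenvalue_pair s = eigenvalue_list A ! fst s * eigenvalue_list A ! snd s"

lemma norm_eigenvalue_pair_le:
  assumes "s \<in> {(i, j). i \<le> j \<and> j < CARD('n)}"
  shows "norm (eigenvalue_pair s) \<le> \<rho>\<^sup>2"
  using assms norm_eigenvalue_le rho_nonneg
  by (auto simp: eigenvalue_pair_def norm_mult power2_eq_square intro!: mult_mono)

lemma weight_coeff_eq_fps_nth:
  "fps_nth (\<Prod>s\<in>{(i, j). i \<le> j \<and> j < CARD('n)}. geometric_fps (eigenvalue_pair s)) n =
    weight_coeff (\<lambda>m. trace (matrix_power A m)) n"
proof (rule weight_coeff_unique)
  have half: "x = y / 2" if "2 * x = y" for x y :: complex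
    using that by auto
  have "2 * (\<Sum>s\<in>{(i, j). i \<le> j \<and> j < CARD('n)}. eigenvalue_pair s ^ m) =
      (trace (matrix_power A m))\<^sup>2 + trace (matrix_power A (2 * m))" for m
    using sum_le_pairs[where N = "CARD('n)" and f = "\<lambda>i. eigenvalue_list A ! i ^ m"]
    unfolding sum_eigenvalue_power power_mult[symmetric]
    by (simp add: eigenvalue_pair_def case_prod_beta power_mult_distrib mult.commute[of m])
  hence "(\<Sum>s\<in>{(i, j). i \<le> j \<and> j < CARD('n)}. eigenvalue_pair s ^ m) =
      ((trace (matrix_power A m))\<^sup>2 + trace (matrix_power A (2 * m))) / 2" for m
    by (rule half)
  thus "of_nat n * fps_nth (\<Prod>s\<in>{(i, j). i \<le> j \<and> j < CARD('n)}. geometric_fps (eigenvalue_pair s)) n =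
      (\<Sum>m\<in>{1..n}. ((trace (matrix_power A m))\<^sup>2 + trace (matrix_power A (2 * m))) / 2 *
        fps_nth (\<Prod>s\<in>{(i, j). i \<le> j \<and> j < CARD('n)}. geometric_fps (eigenvalue_pair s)) (n - m))" for n
    unfolding prod_geometric_fps_recurrence[OF finite_le_pairs] by (simp only:)
next
  have "fps_nth (\<Prod>s\<in>S. geometric_fps (f s)) 0 = 1" for S and f :: "nat \<times> nat \<Rightarrow> complex"
    by (induction S rule: infinite_finite_induct) (auto simp: geometric_fps_def)
  thus "fps_nth (\<Prod>s\<in>{(i, j). i \<le> j \<and> j < CARD('n)}. geometric_fps (eigenvalue_pair s)) 0 = 1" .
qed

lemma weight_O_sums:
  assumes "\<rho> < 1"
  shows "weight_coeff (\<lambda>m. trace (matrix_power A m)) sums weight_O A"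
proof -
  have "\<rho>\<^sup>2 < 1" using assms rho_nonneg by (simp add: abs_square_less_1)
  hence "fps_nth (\<Prod>s\<in>{(i, j). i \<le> j \<and> j < CARD('n)}. geometric_fps (eigenvalue_pair s)) sums
    (\<Prod>s\<in>{(i, j). i \<le> j \<and> j < CARD('n)}. 1 / (1 - eigenvalue_pair s))"
    by (intro prod_geometric_fps_sums[where \<rho> = "\<rho>\<^sup>2"] finite_le_pairs norm_eigenvalue_pair_le)
  also have "(\<Prod>s\<in>{(i, j). i \<le> j \<and> j < CARD('n)}. 1 / (1 - eigenvalue_pair s)) = weight_O A"
    by (simp add: Let_def weight_O_def eigenvalue_pair_def case_prod_beta)
  finally show ?thesis unfolding weight_coeff_eq_fps_nth .
qed

lemma norm_weight_coeff_le:
  "norm (weight_coeff (\<lambda>m. trace (matrix_power A m)) n) \<le>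
    fps_nth (\<Prod>s\<in>{(i, j). i \<le> j \<and> j < CARD('n)}. geometric_fps (\<rho>\<^sup>2)) n"
  unfolding weight_coeff_eq_fps_nth[symmetric]
  by (intro norm_prod_geometric_fps_le finite_le_pairs norm_eigenvalue_pair_le)

end

section \<open>Pairing with the weight\<close>

inductive power_sum_poly :: "nat \<Rightarrow> (complex ^ 'n ^ 'n \<Rightarrow> complex) \<Rightarrow> bool" where
  monom: "is_partition G \<Longrightarrow> power_sum_poly (\<Sum>\<^sub># G) (power_sum_trace G)"
| zero: "power_sum_poly d (\<lambda>_. 0)"
| add: "power_sum_poly d f \<Longrightarrow> power_sum_poly d g \<Longrightarrow> power_sum_poly d (\<lambda>U. f U + g U)"
| scale: "power_sum_poly d f \<Longrightarrow> power_sum_poly d (\<lambda>U. c * f U)"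

lemma power_sum_poly_sum:
  assumes "\<And>m. m \<in> S \<Longrightarrow> power_sum_poly d (f m)"
  shows "power_sum_poly d (\<lambda>U. \<Sum>m\<in>S. f m U)"
  using assms
  by (induction S rule: infinite_finite_induct) (auto intro: power_sum_poly.intros)

lemma power_sum_poly_mult_trace:
  assumes "power_sum_poly d g" "0 < k"
  shows "power_sum_poly (k + d) (\<lambda>U. trace (matrix_power U k) * g U)"
  using assms
proof (induction rule: power_sum_poly.induct)
  case (monom G)
  have poly: "power_sum_poly (\<Sum>\<^sub># (add_mset k G)) (power_sum_trace (add_mset k G) :: complex ^ 'n ^ 'n \<Rightarrow> complex)"
    using monom by (intro power_sum_poly.monom) simp
  have eq: "(power_sum_trace (add_mset k G) :: complex ^ 'n ^ 'n \<Rightarrow> complex) =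
      (\<lambda>U. trace (matrix_power U k) * power_sum_trace G U)"
    by (simp add: fun_eq_iff)
  show ?case using poly unfolding eq by simp
next
  case (add d f g)
  thus ?case by (auto simp: distrib_left intro: power_sum_poly.add)
next
  case (scale d f c)
  thus ?case by (auto simp: mult.left_commute intro: power_sum_poly.scale)
qed (simp add: power_sum_poly.zero)

lemma continuous_on_power_sum_poly:
  assumes "power_sum_poly d g"
  shows "continuous_on UNIV g"
  using assms
  by (induction rule: power_sum_poly.induct) (auto intro!: matrix_continuous_intros continuous_on_power_sum_trace[OF continuous_on_id, simplified])

lemma matrix_power_scalar: "matrix_power (mat z ** U) k = mat (z ^ k) ** matrix_power U k"
  for U :: "complex ^ 'n ^ 'n"
proof -
  show ?thesis
  proof (induction k)
    case (Suc k)
    have "(mat z ** U ** (mat (z ^ k) ** matrix_power U k)) $ i $ j =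
        (mat (z ^ Suc k) ** (U ** matrix_power U k)) $ i $ j" for i j
      unfolding mat_mult_nth matrix_mult_nth[of "mat z ** U"] matrix_mult_nth[of U] sum_distrib_left power_Suc
      by (intro sum.cong refl) (simp only: mult_ac)
    hence "mat z ** U ** (mat (z ^ k) ** matrix_power U k) = mat (z ^ Suc k) ** (U ** matrix_power U k)"
      unfolding vec_eq_iff by blast
    thus ?case by (simp only: matrix_power_Suc Suc)
  qed simp
qed

lemma scaleR_eq_mat_mult: "r *\<^sub>R U = mat (of_real r) ** U" for U :: "complex ^ 'n ^ 'n"
  by (simp add: vec_eq_iff mat_mult_nth complex_eq_iff)

lemma trace_scalar: "trace (mat z ** B) = z * trace B" for B :: "complex ^ 'n ^ 'n"
  by (simp add: trace_def mat_mult_nth sum_distrib_left)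

lemma power_sum_trace_scalar:
  "power_sum_trace F (mat z ** U) = z ^ (\<Sum>\<^sub># F) * power_sum_trace F U" for U :: "complex ^ 'n ^ 'n"
  by (induction F) (auto simp: matrix_power_scalar trace_scalar power_add)

lemma power_sum_poly_scalar:
  assumes "power_sum_poly d g"
  shows "g (mat z ** U) = z ^ d * g U"
  using assms by (induction rule: power_sum_poly.induct)
    (auto simp: power_sum_trace_scalar algebra_simps)

definition weight_part :: "nat \<Rightarrow> complex ^ 'n ^ 'n \<Rightarrow> complex" where
  "weight_part n U = weight_coeff (\<lambda>m. trace (matrix_power U m)) n"

lemma weight_part_0 [simp]: "weight_part 0 U = 1"
  by (simp add: weight_part_def)

lemma weight_part_rec:
  assumes "0 < n"
  shows "weight_part n U = (\<Sum>m\<in>{1..n}. 1 / (2 * of_nat n) *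
    (trace (matrix_power U m) * (trace (matrix_power U m) * weight_part (n - m) U)
      + trace (matrix_power U (2 * m)) * weight_part (n - m) U))"
proof -
  have gen: "(x\<^sup>2 + y) / 2 * w / N = 1 / (2 * N) * (x * (x * w) + y * w)" for x y w N :: complex
    by (simp add: field_simps power2_eq_square)
  show ?thesis
    unfolding weight_part_def using assms
    by (subst weight_coeff.simps) (simp only: sum_divide_distrib gen if_False neq0_conv[symmetric])
qed

lemma power_sum_poly_weight_part:
  "power_sum_poly (2 * n) (weight_part n :: complex ^ 'n ^ 'n \<Rightarrow> complex)"
proof (induction n rule: less_induct)
  case (less n)
  show ?case
  proof (cases "n = 0")
    case True
    have poly: "power_sum_poly (\<Sum>\<^sub># {#}) (power_sum_trace {#} :: complex ^ 'n ^ 'n \<Rightarrow> complex)"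
      by (rule power_sum_poly.monom) (simp add: is_partition_def)
    have eq: "(power_sum_trace {#} :: complex ^ 'n ^ 'n \<Rightarrow> complex) = weight_part 0"
      by (simp add: fun_eq_iff)
    show ?thesis using poly unfolding eq True sum_mset.empty mult_0_right .
  next
    case False
    have "power_sum_poly (2 * n) (\<lambda>U :: complex ^ 'n ^ 'n. \<Sum>m\<in>{1..n}. 1 / (2 * of_nat n) *
      (trace (matrix_power U m) * (trace (matrix_power U m) * weight_part (n - m) U)
        + trace (matrix_power U (2 * m)) * weight_part (n - m) U))"
    proof (intro power_sum_poly_sum power_sum_poly.scale power_sum_poly.add)
      fix m assume m: "m \<in> {1..n}"
      have IH: "power_sum_poly (2 * (n - m)) (weight_part (n - m) :: complex ^ 'n ^ 'n \<Rightarrow> complex)"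
        using m by (intro less) auto
      have d1: "m + (m + 2 * (n - m)) = 2 * n" and d2: "2 * m + 2 * (n - m) = 2 * n" using m by auto
      show "power_sum_poly (2 * n) (\<lambda>U :: complex ^ 'n ^ 'n.
          trace (matrix_power U m) * (trace (matrix_power U m) * weight_part (n - m) U))"
        using power_sum_poly_mult_trace[OF power_sum_poly_mult_trace[OF IH, of m], of m] m unfolding d1 by simp
      show "power_sum_poly (2 * n) (\<lambda>U :: complex ^ 'n ^ 'n. trace (matrix_power U (2 * m)) * weight_part (n - m) U)"
        using power_sum_poly_mult_trace[OF IH, of "2 * m"] m unfolding d2 by simp
    qed
    moreover have "(weight_part n :: complex ^ 'n ^ 'n \<Rightarrow> complex) = (\<lambda>U. \<Sum>m\<in>{1..n}. 1 / (2 * of_nat n) *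
      (trace (matrix_power U m) * (trace (matrix_power U m) * weight_part (n - m) U)
        + trace (matrix_power U (2 * m)) * weight_part (n - m) U))"
      using False by (intro ext weight_part_rec) simp
    ultimately show ?thesis by simp
  qed
qed

lemma power_bounded_scaled_unitary:
  fixes U :: "complex ^ 'n ^ 'n"
  assumes "U \<in> unitary_group" "0 \<le> r"
  shows "power_bounded_matrix (r *\<^sub>R U) r"
proof
  fix k i j
  have "matrix_power (r *\<^sub>R U) k $ i $ j = of_real r ^ k * matrix_power U k $ i $ j"
    by (simp add: scaleR_eq_mat_mult matrix_power_scalar mat_mult_nth)
  thus "norm (matrix_power (r *\<^sub>R U) k $ i $ j) \<le> r ^ k"
    using assms(2) norm_unitary_nth_le_1[OF unitary_matrix_power[OF assms(1)], of k i j]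
    by (simp add: norm_mult norm_power mult_left_le)
qed (rule assms)

lemma weight_coeff_scaled:
  fixes U :: "complex ^ 'n ^ 'n"
  shows "weight_coeff (\<lambda>m. trace (matrix_power (r *\<^sub>R U) m)) n = of_real r ^ (2 * n) * weight_part n U"
proof -
  have "trace (matrix_power (r *\<^sub>R U) m) = of_real r ^ m * trace (matrix_power U m)" for m
    by (simp add: scaleR_eq_mat_mult matrix_power_scalar trace_scalar)
  thus ?thesis by (simp add: weight_coeff_scale weight_part_def)
qed

lemma weight_part_sums_weight_O:
  fixes U :: "complex ^ 'n ^ 'n"
  assumes "U \<in> unitary_group" "0 < r" "r < 1"
  shows "(\<lambda>n. of_real r ^ (2 * n) * weight_part n U) sums weight_O (r *\<^sub>R U)"
proof -
  interpret power_bounded_matrix "r *\<^sub>R U" r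
    using power_bounded_scaled_unitary[OF assms(1)] assms by simp
  have "weight_coeff (\<lambda>m. trace (matrix_power (r *\<^sub>R U) m)) = (\<lambda>n. of_real r ^ (2 * n) * weight_part n U)"
    by (simp add: fun_eq_iff weight_coeff_scaled)
  thus ?thesis using weight_O_sums assms by simp
qed

context haar_unitary
begin

lemma integrable_power_sum_poly:
  assumes "power_sum_poly d g"
  shows "integrable M (\<lambda>U. power_sum_trace F U * cnj (g U))"
  by (intro integrable_continuous matrix_continuous_intros continuous_on_power_sum_poly[OF assms])

lemma integral_mult_trace_adjoint:
  assumes "power_sum_poly d g" "0 < k" "is_partition F" "\<Sum>\<^sub># F = k + d" "k + d \<le> CARD('n)"
  shows "(\<integral>U. power_sum_trace F U * cnj (trace (matrix_power U k) * g U) \<partial>M) =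
    of_nat k * of_nat (count F k) * (\<integral>U. power_sum_trace (F - {#k#}) U * cnj (g U) \<partial>M)"
  using assms
proof (induction rule: power_sum_poly.induct)
  case (monom G)
  have "pair_integral F (add_mset k G) = of_nat k * of_nat (count F k) * pair_integral (F - {#k#}) G"
  proof (cases "k \<in># F")
    case True
    have "\<Sum>\<^sub># (F - {#k#}) = \<Sum>\<^sub># G"
      using sum_mset_remove1_eq[OF True] monom by simp
    thus ?thesis
      using monom diff_partition[of F k]
      by (simp add: pair_integral_eq_power_sum_pairing power_sum_pairing_add_mset_right)
  next
    case False
    thus ?thesis
      using monom by (simp add: pair_integral_eq_power_sum_pairing power_sum_pairing_add_mset_right not_in_iff)
  qed
  thus ?case by (simp add: pair_integral_def)
next
  case (add d f g)
  thus ?case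
    by (simp add: distrib_left integrable_power_sum_poly
      integrable_power_sum_poly[OF power_sum_poly_mult_trace, simplified])
next
  case (scale d f c)
  thus ?case by (simp add: mult.left_commute)
qed simp

lemma integral_weight_part:
  assumes "is_partition F" "\<Sum>\<^sub># F = 2 * n" "2 * n \<le> CARD('n)"
  shows "(\<integral>U. power_sum_trace F U * cnj (weight_part n U) \<partial>M) = gauss_moment CARD('n) F"
  using assms
proof (induction n arbitrary: F rule: less_induct)
  case (less n)
  let ?I = "\<lambda>F g. (\<integral>U. power_sum_trace F U * cnj (g U) \<partial>M)"
  let ?M = "gauss_moment CARD('n)"
  show ?case
  proof (cases "n = 0")
    case True
    hence "F = {#}" using less.prems(2) by (intro partition_of_0[OF less.prems(1)]) simp
    thus ?thesis using True by (simp add: prob_space)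
  next
    case False
    define X where "X m = of_nat m * of_nat (count F m) * (of_nat m * of_nat (count (F - {#m#}) m) * ?M (F - {#m#} - {#m#}))" for m
    define Y where "Y m = of_nat m * of_nat (count F m) * ?M (F - {#m#})" for m
    have term1: "?I F (\<lambda>U. trace (matrix_power U m) * (trace (matrix_power U m) * weight_part (n - m) U)) = X m"
      if m: "m \<in> {1..n}" for m
    proof -
      note poly = power_sum_poly_weight_part[of "n - m"]
      have "?I F (\<lambda>U. trace (matrix_power U m) * (trace (matrix_power U m) * weight_part (n - m) U)) =
        of_nat m * of_nat (count F m) * ?I (F - {#m#}) (\<lambda>U. trace (matrix_power U m) * weight_part (n - m) U)"
        by (rule integral_mult_trace_adjoint[OF power_sum_poly_mult_trace[OF poly]])
           (use m less.prems in auto)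
      also have "\<dots> = X m"
      proof (cases "m \<in># F")
        case True
        have s1: "m + \<Sum>\<^sub># (F - {#m#}) = 2 * n"
          using sum_mset_remove1_eq[OF True] less.prems by simp
        have "?I (F - {#m#}) (\<lambda>U. trace (matrix_power U m) * weight_part (n - m) U) =
          of_nat m * of_nat (count (F - {#m#}) m) * ?I (F - {#m#} - {#m#}) (weight_part (n - m))"
          by (rule integral_mult_trace_adjoint[OF poly])
             (use m less.prems s1 diff_partition in auto)
        also have "\<dots> = of_nat m * of_nat (count (F - {#m#}) m) * ?M (F - {#m#} - {#m#})"
        proof (cases "m \<in># F - {#m#}")
          case m': True
          have "\<Sum>\<^sub># (F - {#m#} - {#m#}) = 2 * (n - m)"
            using sum_mset_remove1_eq[OF m'] s1 by simp
          hence "?I (F - {#m#} - {#m#}) (weight_part (n - m)) = ?M (F - {#m#} - {#m#})"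
            using m less.prems by (intro less.IH diff_partition) auto
          thus ?thesis by simp
        qed (simp only: not_in_iff of_nat_0 mult_zero_left mult_zero_right)
        finally show ?thesis by (simp add: X_def)
      qed (simp add: X_def not_in_iff)
      finally show ?thesis .
    qed
    have term2: "?I F (\<lambda>U. trace (matrix_power U (2 * m)) * weight_part (n - m) U) = Y (2 * m)"
      if m: "m \<in> {1..n}" for m
    proof -
      have "?I F (\<lambda>U. trace (matrix_power U (2 * m)) * weight_part (n - m) U) =
        of_nat (2 * m) * of_nat (count F (2 * m)) * ?I (F - {#2 * m#}) (weight_part (n - m))"
        by (rule integral_mult_trace_adjoint[OF power_sum_poly_weight_part]) (use m less.prems in auto)
      also have "\<dots> = Y (2 * m)"
      proof (cases "2 * m \<in># F")
        case True
        have "\<Sum>\<^sub># (F - {#2 * m#}) = 2 * (n - m)"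
          using sum_mset_remove1_eq[OF True] less.prems by simp
        hence "?I (F - {#2 * m#}) (weight_part (n - m)) = ?M (F - {#2 * m#})"
          using m less.prems by (intro less.IH diff_partition) auto
        thus ?thesis by (simp add: Y_def)
      qed (simp add: Y_def not_in_iff)
      finally show ?thesis .
    qed
    have i1: "integrable M (\<lambda>U. power_sum_trace F U * cnj (trace (matrix_power U m) * (trace (matrix_power U m) * weight_part (n - m) U)))"
      and i2: "integrable M (\<lambda>U. power_sum_trace F U * cnj (trace (matrix_power U (2 * m)) * weight_part (n - m) U))" for m
      by (intro integrable_continuous matrix_continuous_intros
          continuous_on_power_sum_poly[OF power_sum_poly_weight_part])+
    have "?I F (weight_part n) = (\<integral>U. (\<Sum>m\<in>{1..n}. 1 / (2 * of_nat n) *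
        (power_sum_trace F U * cnj (trace (matrix_power U m) * (trace (matrix_power U m) * weight_part (n - m) U))
         + power_sum_trace F U * cnj (trace (matrix_power U (2 * m)) * weight_part (n - m) U))) \<partial>M)"
      using False
      by (subst weight_part_rec) (auto simp: sum_distrib_left field_simps intro!: Bochner_Integration.integral_cong sum.cong)
    also have "\<dots> = (\<Sum>m\<in>{1..n}. 1 / (2 * of_nat n) *
        (?I F (\<lambda>U. trace (matrix_power U m) * (trace (matrix_power U m) * weight_part (n - m) U))
         + ?I F (\<lambda>U. trace (matrix_power U (2 * m)) * weight_part (n - m) U)))"
      by (simp only: Bochner_Integration.integral_sum Bochner_Integration.integral_add integral_mult_right_zero
          integrable_mult_right Bochner_Integration.integrable_add i1 i2)
    also have "\<dots> = (\<Sum>m\<in>{1..n}. 1 / (2 * of_nat n) * (X m + Y (2 * m)))"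
      by (intro sum.cong) (simp_all add: term1 term2 del: complex_cnj_mult)
    also have "\<dots> = 1 / (2 * of_nat n) * ((\<Sum>m\<in>{1..n}. X m) + (\<Sum>m\<in>{1..n}. Y (2 * m)))"
      unfolding sum_distrib_left[symmetric] sum.distrib ..
    finally have I: "2 * of_nat n * ?I F (weight_part n) = (\<Sum>m\<in>{1..n}. X m) + (\<Sum>m\<in>{1..n}. Y (2 * m))"
      using False by simp
    have "2 * of_nat n * ?M F = (\<Sum>k\<in>{1..2 * n}. X k + of_bool (even k) * Y k)"
      using gauss_moment_euler[OF less.prems(1), of "2 * n" "CARD('n)"] less.prems(2)
      by (simp add: X_def Y_def algebra_simps)
    also have "\<dots> = (\<Sum>k\<in>{1..2 * n}. X k) + (\<Sum>k\<in>{1..2 * n}. of_bool (even k) * Y k)"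
      by (simp add: sum.distrib)
    also have "(\<Sum>k\<in>{1..2 * n}. X k) = (\<Sum>k\<in>{1..n}. X k)"
    proof (rule sum.mono_neutral_right)
      show "\<forall>k\<in>{1..2 * n} - {1..n}. X k = 0"
      proof
        fix k assume k: "k \<in> {1..2 * n} - {1..n}"
        show "X k = 0"
        proof (cases "k \<in># F \<and> k \<in># F - {#k#}")
          case True
          have "k + (k + \<Sum>\<^sub># (F - {#k#} - {#k#})) = 2 * n"
            using sum_mset_remove1_eq[of k F] sum_mset_remove1_eq[of k "F - {#k#}"] True less.prems by simp
          thus ?thesis using k by auto
        next
          case False
          hence "count F k = 0 \<or> count (F - {#k#}) k = 0" by (metis not_in_iff)
          thus ?thesis unfolding X_def by (auto simp del: count_diff)
        qed
      qed
    qed auto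
    also have "(\<Sum>k\<in>{1..2 * n}. of_bool (even k) * Y k) = (\<Sum>k\<in>{k\<in>{1..2 * n}. even k}. Y k)"
      unfolding sum.inter_filter[OF finite_atLeastAtMost] by (intro sum.cong) auto
    also have "\<dots> = (\<Sum>m\<in>{1..n}. Y (2 * m))"
      by (rule sum.reindex_bij_witness[of _ "\<lambda>m. 2 * m" "\<lambda>k. k div 2"]) auto
    finally have "2 * of_nat n * ?M F = 2 * of_nat n * ?I F (weight_part n)"
      unfolding I .
    thus ?thesis using False by simp
  qed
qed

lemma integral_weight_part_eq_0:
  assumes "\<Sum>\<^sub># F \<noteq> 2 * n"
  shows "(\<integral>U. power_sum_trace F U * cnj (weight_part n U) \<partial>M) = 0"
  using continuous_on_power_sum_trace[OF continuous_on_id, of UNIV F]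
  by (intro integral_homogeneous_eq_0[OF _ _ power_sum_trace_scalar power_sum_poly_scalar assms]
      continuous_on_power_sum_poly[OF power_sum_poly_weight_part] power_sum_poly_weight_part) simp_all

lemma weight_series_measurable:
  "(\<lambda>U. power_sum_trace F U * cnj (\<Sum>n. of_real r ^ (2 * n) * weight_part n U)) \<in> borel_measurable M"
proof -
  have "(\<lambda>U. \<Sum>n. of_real r ^ (2 * n) * weight_part n U) \<in> borel_measurable M"
    by (intro borel_measurable_suminf borel_measurable_continuous continuous_intros
        continuous_on_power_sum_poly[OF power_sum_poly_weight_part])
  moreover have "cnj \<in> borel_measurable borel"
    by (intro borel_measurable_continuous_onI continuous_intros)
  ultimately have m: "(\<lambda>U. cnj (\<Sum>n. of_real r ^ (2 * n) * weight_part n U)) \<in> borel_measurable M"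
    by (rule measurable_compose)
  show ?thesis
    by (rule borel_measurable_times[OF _ m])
       (intro borel_measurable_continuous continuous_on_power_sum_trace continuous_on_id)
qed

theorem integral_weight_series:
  assumes F: "is_partition F" "\<Sum>\<^sub># F \<le> CARD('n)" and r: "0 < r" "r < 1"
  shows "(\<integral>U. power_sum_trace F U * cnj (\<Sum>n. of_real r ^ (2 * n) * weight_part n U) \<partial>M) =
    of_real r ^ (\<Sum>\<^sub># F) * gauss_moment CARD('n) F"
proof -
  define b where "b = fps_nth (\<Prod>s\<in>{(i, j). i \<le> j \<and> j < CARD('n)}. geometric_fps (r\<^sup>2))"
  define t where "t n U = power_sum_trace F U * cnj (of_real r ^ (2 * n) * weight_part n U)" for n and U :: "complex ^ 'n ^ 'n"
  have "r\<^sup>2 < 1" using r by (simp add: abs_square_less_1)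
  hence b: "summable b"
    unfolding b_def using r
    by (intro sums_summable[OF prod_geometric_fps_sums[where \<rho> = "r\<^sup>2"]] finite_le_pairs) auto
  have "bounded (power_sum_trace F ` (unitary_group :: (complex ^ 'n ^ 'n) set))"
    by (intro compact_imp_bounded compact_continuous_image compact_unitary_group)
       (use continuous_on_power_sum_trace[OF continuous_on_id] in simp)
  then obtain K where K: "\<And>U :: complex ^ 'n ^ 'n. U \<in> unitary_group \<Longrightarrow> norm (power_sum_trace F U) \<le> K"
    by (auto simp: bounded_iff)
  have bound: "norm (t n U) \<le> K * b n" if U: "U \<in> unitary_group" for n U
  proof -
    interpret power_bounded_matrix "r *\<^sub>R U" r
      using power_bounded_scaled_unitary[OF U] r by simp
    have "norm (of_real r ^ (2 * n) * weight_part n U) \<le> b n"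
      using norm_weight_coeff_le[of n] by (simp add: weight_coeff_scaled b_def)
    thus ?thesis
      using K[OF U] order_trans[OF norm_ge_zero K[OF U]]
      unfolding t_def norm_mult[of "power_sum_trace F U"] complex_mod_cnj by (intro mult_mono) auto
  qed
  have int: "integrable M (t n)" for n
    unfolding t_def
    by (intro integrable_continuous matrix_continuous_intros continuous_on_power_sum_poly[OF power_sum_poly_weight_part])
  have Kb: "summable (\<lambda>n. K * b n)" by (rule summable_mult[OF b])
  have "(\<lambda>n. \<integral>U. t n U \<partial>M) sums (\<integral>U. (\<Sum>n. t n U) \<partial>M)"
  proof (rule sums_integral[OF int])
    show "AE U in M. summable (\<lambda>n. norm (t n U))"
      using AE_unitary by eventually_elim (rule summable_comparison_test'[OF Kb], simp add: bound)
    have "(\<integral>U. norm (t n U) \<partial>M) \<le> K * b n" for n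
    proof -
      have "(\<integral>U. norm (t n U) \<partial>M) \<le> (\<integral>U. K * b n \<partial>M)"
        using int AE_unitary by (intro integral_mono_AE) (auto simp: bound)
      thus ?thesis by (simp add: prob_space)
    qed
    thus "summable (\<lambda>n. \<integral>U. norm (t n U) \<partial>M)"
      by (intro summable_comparison_test'[OF Kb]) simp
  qed
  moreover have "(\<integral>U. (\<Sum>n. t n U) \<partial>M) =
      (\<integral>U. power_sum_trace F U * cnj (\<Sum>n. of_real r ^ (2 * n) * weight_part n U) \<partial>M)"
  proof (rule integral_cong_AE)
    show "AE U in M. (\<Sum>n. t n U) = power_sum_trace F U * cnj (\<Sum>n. of_real r ^ (2 * n) * weight_part n U)"
      using AE_unitary
    proof eventually_elim
      case (elim U)
      have "(\<lambda>n. of_real r ^ (2 * n) * weight_part n U) sums weight_O (r *\<^sub>R U)"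
        by (rule weight_part_sums_weight_O[OF elim r])
      hence "(\<lambda>n. of_real r ^ (2 * n) * weight_part n U) sums (\<Sum>n. of_real r ^ (2 * n) * weight_part n U)"
        by (simp add: sums_iff)
      hence "(\<lambda>n. t n U) sums (power_sum_trace F U * cnj (\<Sum>n. of_real r ^ (2 * n) * weight_part n U))"
        unfolding t_def by (intro sums_mult) (simp only: sums_cnj)
      thus ?case by (simp add: sums_iff)
    qed
    show "(\<lambda>U. \<Sum>n. t n U) \<in> borel_measurable M"
      by (intro borel_measurable_suminf borel_measurable_integrable int)
    show "(\<lambda>U. power_sum_trace F U * cnj (\<Sum>n. of_real r ^ (2 * n) * weight_part n U)) \<in> borel_measurable M"
      by (rule weight_series_measurable)
  qed
  moreover have "(\<lambda>n. \<integral>U. t n U \<partial>M) sums (of_real r ^ (\<Sum>\<^sub># F) * gauss_moment CARD('n) F)"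
  proof -
    have t: "(\<integral>U. t n U \<partial>M) = of_real r ^ (2 * n) * (\<integral>U. power_sum_trace F U * cnj (weight_part n U) \<partial>M)" for n
    proof -
      have "t n = (\<lambda>U. of_real r ^ (2 * n) * (power_sum_trace F U * cnj (weight_part n U)))"
        by (simp add: t_def fun_eq_iff mult_ac)
      thus ?thesis by simp
    qed
    have "(\<integral>U. t n U \<partial>M) = (if n = \<Sum>\<^sub># F div 2 then of_real r ^ (\<Sum>\<^sub># F) * gauss_moment CARD('n) F else 0)" for n
    proof (cases "\<Sum>\<^sub># F = 2 * n")
      case True
      thus ?thesis using integral_weight_part[OF F(1) True] F by (simp add: t)
    next
      case False
      moreover have "gauss_moment CARD('n) F = 0" if "n = \<Sum>\<^sub># F div 2"
        using that False by (intro gauss_moment_odd F) presburger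
      ultimately show ?thesis by (simp add: t integral_weight_part_eq_0)
    qed
    thus ?thesis
      using sums_single[of "\<Sum>\<^sub># F div 2" "\<lambda>_. of_real r ^ (\<Sum>\<^sub># F) * gauss_moment CARD('n) F"]
      by (simp only:)
  qed
  ultimately show ?thesis by (metis sums_unique2)
qed

end

section \<open>Haar measures\<close>

lemma continuous_on_mult_left_matrix: "continuous_on S (\<lambda>U :: complex ^ 'n ^ 'n. g ** U)"
  for g :: "complex ^ 'n ^ 'n"
  by (intro continuous_on_matrix_mult continuous_on_const continuous_on_id)

lemma haar_unitary_distr:
  fixes MU :: "(complex ^ 'n ^ 'n) measure"
  assumes "haar_prob_measure unitary_group MU"
  shows "haar_unitary (distr MU borel (\<lambda>U. U))"
    and "(\<lambda>U. U) \<in> MU \<rightarrow>\<^sub>M borel" and "space MU = unitary_group"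
proof -
  have prob: "prob_space MU" and sets: "sets MU = sets (restrict_space borel unitary_group)"
    and inv: "\<And>g. g \<in> unitary_group \<Longrightarrow> distr MU MU (\<lambda>h. g ** h) = MU"
    using assms by (auto simp: haar_prob_measure_def)
  show space: "space MU = unitary_group"
    using sets_eq_imp_space_eq[OF sets] by (simp add: space_restrict_space)
  show id: "(\<lambda>U. U) \<in> MU \<rightarrow>\<^sub>M borel"
    unfolding measurable_cong_sets[OF sets refl] by (rule measurable_restrict_space1) simp
  interpret prob_space MU by (rule prob)
  let ?N = "distr MU borel (\<lambda>U. U)"
  interpret N: prob_space ?N by (rule prob_space_distr[OF id])
  have unitary: "unitary_group \<in> sets (borel :: (complex ^ 'n ^ 'n) measure)"
    by (intro borel_closed compact_imp_closed compact_unitary_group)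
  interpret N: unitary_ensemble ?N
  proof
    show "AE U in ?N. U \<in> unitary_group"
      using unitary by (subst AE_distr_iff[OF id]) (auto simp: space[symmetric])
  qed simp
  show "haar_unitary ?N"
  proof
    fix g :: "complex ^ 'n ^ 'n" assume g: "g \<in> unitary_group"
    have mult: "(\<lambda>U :: complex ^ 'n ^ 'n. g ** U) \<in> borel \<rightarrow>\<^sub>M borel"
      by (intro borel_measurable_continuous_onI continuous_on_mult_left_matrix)
    have multM: "(\<lambda>h. g ** h) \<in> MU \<rightarrow>\<^sub>M MU"
      unfolding measurable_cong_sets[OF sets sets]
      by (rule measurable_restrict_space3[OF mult]) (auto intro: unitary_group_mult g)
    have "distr ?N borel ((**) g) = distr MU borel (\<lambda>U. g ** U)"
      by (subst distr_distr[OF mult id]) (simp add: comp_def)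
    also have "\<dots> = distr (distr MU MU (\<lambda>h. g ** h)) borel (\<lambda>U. U)"
      by (subst distr_distr[OF id multM]) (simp add: comp_def)
    also have "\<dots> = distr ?N borel (\<lambda>U. U)"
      unfolding inv[OF g] by (simp add: distr_distr[OF _ id] comp_def)
    finally show "N.invariant_under g"
      by (simp add: N.invariant_under_def)
  qed
qed

definition complexify :: "real ^ 'n ^ 'n \<Rightarrow> complex ^ 'n ^ 'n" where
  "complexify = map_matrix complex_of_real"

lemma complexify_nth [simp]: "complexify Q $ i $ j = of_real (Q $ i $ j)"
  by (simp add: complexify_def)

lemma complexify_mult: "complexify (P ** Q) = complexify P ** complexify Q"
  by (simp add: vec_eq_iff matrix_mult_nth)

lemma complexify_mat_1: "complexify (mat 1) = mat 1"
  by (simp add: vec_eq_iff mat_def)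

lemma complexify_inject: "complexify P = complexify Q \<longleftrightarrow> P = Q"
  by (simp add: vec_eq_iff)

lemma adj_complexify: "adj (complexify Q) = complexify (Finite_Cartesian_Product.transpose Q)"
  by (simp add: vec_eq_iff adj_nth Finite_Cartesian_Product.transpose_def)

lemma complexify_in_unitary_group: "complexify Q \<in> unitary_group \<longleftrightarrow> Q \<in> orthogonal_group"
  unfolding in_unitary_group orthogonal_group_def orthogonal_matrix_def mem_Collect_eq
    adj_complexify complexify_mult[symmetric] complexify_mat_1[symmetric] complexify_inject ..

lemma real_matrix_complexify: "real_matrix (complexify Q)"
  by (simp add: real_matrix_def)

lemma real_matrix_imp_complexify: "real_matrix U \<Longrightarrow> U = complexify (map_matrix Re U)"
  by (simp add: real_matrix_def vec_eq_iff complex_eq_iff)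

lemma complexify_matrix_power: "complexify (matrix_power Q k) = matrix_power (complexify Q) k"
  by (induction k) (simp_all add: matrix_power_Suc complexify_mult complexify_mat_1)

lemma trace_complexify: "trace (complexify Q) = of_real (trace Q)"
  by (simp add: trace_def)

lemma power_sum_trace_complexify: "power_sum_trace F (complexify Q) = of_real (power_sum_trace F Q)"
  by (induction F) (simp_all add: trace_complexify flip: complexify_matrix_power)

lemma continuous_on_complexify: "continuous_on S complexify"
  unfolding complexify_def map_matrix_def
  by (intro continuous_on_vec_lambda continuous_on_of_real continuous_on_component continuous_on_id)

lemma haar_orthogonal_distr:
  fixes MO :: "(real ^ 'n ^ 'n) measure"
  assumes "haar_prob_measure orthogonal_group MO"
  shows "haar_orthogonal (distr MO borel complexify)" and "complexify \<in> MO \<rightarrow>\<^sub>M borel"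
proof -
  have prob: "prob_space MO" and sets: "sets MO = sets (restrict_space borel orthogonal_group)"
    and inv: "\<And>g. g \<in> orthogonal_group \<Longrightarrow> distr MO MO (\<lambda>h. g ** h) = MO"
    using assms by (auto simp: haar_prob_measure_def)
  have space: "space MO = orthogonal_group"
    using sets_eq_imp_space_eq[OF sets] by (simp add: space_restrict_space)
  show cx: "complexify \<in> MO \<rightarrow>\<^sub>M borel"
    unfolding measurable_cong_sets[OF sets refl]
    by (intro measurable_restrict_space1 borel_measurable_continuous_onI continuous_on_complexify)
  interpret prob_space MO by (rule prob)
  let ?N = "distr MO borel complexify"
  interpret N: prob_space ?N by (rule prob_space_distr[OF cx])
  have unitary: "unitary_group \<in> sets (borel :: (complex ^ 'n ^ 'n) measure)"
    by (intro borel_closed compact_imp_closed compact_unitary_group)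
  have real: "{U :: complex ^ 'n ^ 'n. real_matrix U} \<in> sets borel"
    unfolding real_matrix_def
    by (intro borel_closed closed_Collect_all closed_Collect_eq continuous_on_Im continuous_on_component
        continuous_on_const continuous_on_id)
  interpret N: unitary_ensemble ?N
  proof
    show "AE U in ?N. U \<in> unitary_group"
      using unitary by (subst AE_distr_iff[OF cx]) (auto simp: complexify_in_unitary_group space[symmetric])
  qed simp
  show "haar_orthogonal ?N"
  proof
    show "AE U in ?N. real_matrix U"
      using real by (subst AE_distr_iff[OF cx]) (auto simp: real_matrix_complexify)
    fix g :: "complex ^ 'n ^ 'n" assume g: "g \<in> unitary_group" "real_matrix g"
    define R where "R = map_matrix Re g"
    have gR: "g = complexify R" unfolding R_def by (rule real_matrix_imp_complexify[OF g(2)])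
    have R: "R \<in> orthogonal_group" using g(1) by (simp add: gR complexify_in_unitary_group)
    have mult: "(\<lambda>U :: complex ^ 'n ^ 'n. g ** U) \<in> borel \<rightarrow>\<^sub>M borel"
      by (intro borel_measurable_continuous_onI continuous_on_mult_left_matrix)
    have "(\<lambda>h :: real ^ 'n ^ 'n. R ** h) \<in> borel \<rightarrow>\<^sub>M borel"
      unfolding matrix_matrix_mult_def
      by (intro borel_measurable_continuous_onI continuous_on_vec_lambda continuous_on_sum continuous_on_mult
          continuous_on_component continuous_on_const continuous_on_id)
    hence multM: "(\<lambda>h. R ** h) \<in> MO \<rightarrow>\<^sub>M MO"
      unfolding measurable_cong_sets[OF sets sets]
      by (rule measurable_restrict_space3) (use R in \<open>auto simp: orthogonal_group_def orthogonal_matrix_mul\<close>)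
    have "distr ?N borel ((**) g) = distr MO borel (\<lambda>Q. complexify (R ** Q))"
      by (subst distr_distr[OF mult cx]) (simp add: comp_def gR complexify_mult)
    also have "\<dots> = distr (distr MO MO (\<lambda>h. R ** h)) borel complexify"
      by (subst distr_distr[OF cx multM]) (simp add: comp_def)
    also have "\<dots> = distr ?N borel (\<lambda>U. U)"
      unfolding inv[OF R] by (simp add: distr_distr[OF _ cx] comp_def)
    finally show "N.invariant_under g"
      by (simp add: N.invariant_under_def)
  qed
qed

theorem theorem1p4:
  fixes MU :: "(complex ^ 'n ^ 'n) measure"
    and MO :: "(real ^ 'n ^ 'n) measure"
    and l :: "nat multiset"
  assumes "haar_prob_measure unitary_group MU"
    and "haar_prob_measure orthogonal_group MO"
    and "is_partition l"
    and "partition_size l < CARD('n)"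
  shows "((\<lambda>r::real. \<integral>U. power_sum_trace l U * cnj (weight_O (r *\<^sub>R U)) \<partial>MU)
      \<longlongrightarrow> complex_of_real (\<integral>U. power_sum_trace l U \<partial>MO)) (at_left 1)"
proof -
  note l = assms(3) assms(4)[unfolded partition_size_conv_sum_mset]
  note id = haar_unitary_distr(2,3)[OF assms(1)] and cx = haar_orthogonal_distr(2)[OF assms(2)]
  interpret U: haar_unitary "distr MU borel (\<lambda>U. U)"
    by (rule haar_unitary_distr(1)[OF assms(1)])
  interpret O: haar_orthogonal "distr MO borel complexify"
    by (rule haar_orthogonal_distr(1)[OF assms(2)])
  have unitary: "(\<integral>U. power_sum_trace l U * cnj (weight_O (r *\<^sub>R U)) \<partial>MU) =
      of_real r ^ (\<Sum>\<^sub># l) * gauss_moment CARD('n) l" if r: "0 < r" "r < 1" for r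
  proof -
    have "(\<integral>U. power_sum_trace l U * cnj (weight_O (r *\<^sub>R U)) \<partial>MU) =
        (\<integral>U. power_sum_trace l U * cnj (\<Sum>n. of_real r ^ (2 * n) * weight_part n U) \<partial>MU)"
    proof (rule Bochner_Integration.integral_cong[OF refl])
      fix U assume "U \<in> space MU"
      hence "(\<lambda>n. of_real r ^ (2 * n) * weight_part n U) sums weight_O (r *\<^sub>R U)"
        using weight_part_sums_weight_O r id(2) by blast
      thus "power_sum_trace l U * cnj (weight_O (r *\<^sub>R U)) =
          power_sum_trace l U * cnj (\<Sum>n. of_real r ^ (2 * n) * weight_part n U)"
        by (simp only: sums_iff)
    qed
    also have "\<dots> = (\<integral>U. power_sum_trace l U * cnj (\<Sum>n. of_real r ^ (2 * n) * weight_part n U)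
        \<partial>distr MU borel (\<lambda>U. U))"
      using U.weight_series_measurable by (intro integral_distr[symmetric] id(1)) simp
    also have "\<dots> = of_real r ^ (\<Sum>\<^sub># l) * gauss_moment CARD('n) l"
      using l r by (intro U.integral_weight_series) auto
    finally show ?thesis .
  qed
  have orthogonal: "complex_of_real (\<integral>U. power_sum_trace l U \<partial>MO) = gauss_moment CARD('n) l"
  proof -
    have "complex_of_real (\<integral>U. power_sum_trace l U \<partial>MO) = (\<integral>Q. power_sum_trace l (complexify Q) \<partial>MO)"
      unfolding power_sum_trace_complexify by (rule integral_complex_of_real[symmetric])
    also have "\<dots> = (\<integral>U. power_sum_trace l U \<partial>distr MO borel complexify)"
      by (intro integral_distr[symmetric] cx borel_measurable_continuous_onI continuous_on_power_sum_trace
          continuous_on_id)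
    also have "\<dots> = O.pair_integral l {#}"
      by (simp add: O.pair_integral_def)
    also have "\<dots> = gauss_moment CARD('n) l"
      by (rule O.moment_eq_gauss_moment[OF l])
    finally show ?thesis .
  qed
  have "((\<lambda>r::real. complex_of_real r ^ (\<Sum>\<^sub># l) * gauss_moment CARD('n) l)
      \<longlongrightarrow> complex_of_real 1 ^ (\<Sum>\<^sub># l) * gauss_moment CARD('n) l) (at_left 1)"
    by (intro tendsto_intros)
  moreover have "\<forall>\<^sub>F r::real in at_left 1. complex_of_real r ^ (\<Sum>\<^sub># l) * gauss_moment CARD('n) l =
      (\<integral>U. power_sum_trace l U * cnj (weight_O (r *\<^sub>R U)) \<partial>MU)"
    using eventually_at_left_real[of 0 "1 :: real"] by (rule eventually_mono) (auto simp: unitary)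
  ultimately show ?thesis
    unfolding orthogonal by (simp add: tendsto_cong)
qed

end
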